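(* Let $r \ge 2$, $k\ge1$ and $n\ge 2rk$ be integers and let $A\subseteq[n]$ with $|A| \le b(r)\cdot (k-1)$. Then $$\chi(\mathrm{KG}^r_A(n,k)) = \left\lceil \frac{n - \max\{r(k-1),|A|\}}{r-1}\right\rceil.$$
   Context: For an integer $r\ge2$ with prime factorization $r=2^{\alpha_0}p_1^{\alpha_1}\cdots p_t^{\alpha_t}$ ($p_i$ pairwise distinct odd primes, $\alpha_i\ge0$), $b(r)=2^{\alpha_0}(p_1-1)^{\alpha_1}\cdots(p_t-1)^{\alpha_t}$. For a hypergraph $H$, an $m$-coloring is a map from the vertices to $[m]$ such that no hyperedge is monochromatic; $\chi(H)$ is the least such $m$. $\mathrm{KG}^r(n,k)$ is the hypergraph on the $k$-subsets of $[n]$ whose hyperedges are collections of $r$ pairwise disjoint $k$-subsets. For $A\subseteq[n]$, $\mathrm{KG}^r_A(n,k)$ is the subhypergraph of $\mathrm{KG}^r(n,k)$ induced by the $k$-subsets $\sigma\subseteq[n]$ with $\sigma\not\subseteq A$. *)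

theory Defs
  imports Complex_Main "HOL-Computational_Algebra.Primes"
begin

definition b_num :: "nat \<Rightarrow> nat" where
  "b_num r = 2 ^ multiplicity 2 r * (\<Prod>p \<in> prime_factors r - {2}. (p - 1) ^ multiplicity p r)"

text \<open>A hypergraph is a pair consisting of its vertex set and its set of hyperedges.\<close>

type_synonym 'a hypergraph = "'a set \<times> 'a set set"

definition verts :: "'a hypergraph \<Rightarrow> 'a set" where
  "verts H = fst H"

definition hyperedges :: "'a hypergraph \<Rightarrow> 'a set set" where
  "hyperedges H = snd H"

definition induced_subhypergraph :: "'a hypergraph \<Rightarrow> 'a set \<Rightarrow> 'a hypergraph" where
  "induced_subhypergraph H W = (verts H \<inter> W, {e \<in> hyperedges H. e \<subseteq> W})"

definition monochromatic :: "('a \<Rightarrow> nat) \<Rightarrow> 'a set \<Rightarrow> bool" where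
  "monochromatic c e \<longleftrightarrow> (\<exists>i. \<forall>v\<in>e. c v = i)"

definition is_coloring :: "'a hypergraph \<Rightarrow> nat \<Rightarrow> ('a \<Rightarrow> nat) \<Rightarrow> bool" where
  "is_coloring H m c \<longleftrightarrow>
     (\<forall>v\<in>verts H. c v \<in> {1..m}) \<and> (\<forall>e\<in>hyperedges H. \<not> monochromatic c e)"

definition chromatic_number :: "'a hypergraph \<Rightarrow> nat" where
  "chromatic_number H = (LEAST m. \<exists>c. is_coloring H m c)"

definition KG :: "nat \<Rightarrow> nat \<Rightarrow> nat \<Rightarrow> nat set hypergraph" where
  "KG r n k =
    (let V = {\<sigma>. \<sigma> \<subseteq> {1..n} \<and> card \<sigma> = k}
     in (V, {e. e \<subseteq> V \<and> card e = r \<and> pairwise disjnt e}))"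

definition KG_avoid :: "nat \<Rightarrow> nat set \<Rightarrow> nat \<Rightarrow> nat \<Rightarrow> nat set hypergraph" where
  "KG_avoid r A n k = induced_subhypergraph (KG r n k) {\<sigma>. \<not> \<sigma> \<subseteq> A}"

end

theory Submission
  imports Defs "HOL-Library.Disjoint_Sets" "HOL-Number_Theory.Modular_Inverse"
begin

text \<open>Since \<open>b_num r \<le> r\<close>, it suffices to treat \<open>card A \<le> r * (k - 1)\<close>. For the lower bound one
  shows more generally, for \<open>card A \<le> r * a\<close>, that coloring the \<open>N\<close>-sets meeting \<open>A\<close> in at
  most \<open>a\<close> points with too few colors produces \<open>r\<close> disjoint sets of one color. In this form the
  claim is multiplicative in \<open>r\<close>, so that \<open>r = p\<close> may be taken prime.

  For \<open>r = p\<close>, suppose there is no such family and consider ordered \<open>p\<close>-tuples of disjoint subsets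
  \<open>X\<^sub>i\<close> of the ground set \<open>V\<close>, not all empty. If no \<open>X\<^sub>i\<close> contains an admissible set, the tuple gets
  the rank obtained by summing \<open>min (card (X\<^sub>i \<inter> A)) a + card (X\<^sub>i - A)\<close>; otherwise its rank is
  \<open>p * (N - 1)\<close> plus the number of pairs of an index \<open>i\<close> and a color \<open>v\<close> such that \<open>X\<^sub>i\<close> contains
  an admissible set of color \<open>v\<close>. Comparable tuples of equal rank share the data from which an
  equivariant sign is computed; here \<open>card A \<le> p * a\<close> is needed, because if all the numbers
  \<open>min (card (X\<^sub>i \<inter> A)) a\<close> coincide then comparable tuples of equal rank are equal. A Tucker lemma
  for the cyclic group then bounds \<open>card V\<close> by the number of ranks.

  The Tucker lemma follows by evaluating an explicit cocycle of the cyclic group of order \<open>p\<close>,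
  pulled back along the sign, on a chain built by alternately coning and applying \<open>g - 1\<close> or the
  norm: the value is 1 modulo \<open>p\<close> by Stokes, but 0 if there are too few ranks.\<close>

section \<open>Cochains on lists\<close>

primrec cobd :: "('a list \<Rightarrow> 'b::ab_group_add) \<Rightarrow> 'a list \<Rightarrow> 'b" where
  "cobd f [] = 0"
| "cobd f (x # xs) = f xs - cobd (\<lambda>ys. f (x # ys)) xs"

primrec prism :: "('a \<Rightarrow> 'a) \<Rightarrow> ('a list \<Rightarrow> 'b::ab_group_add) \<Rightarrow> 'a list \<Rightarrow> 'b" where
  "prism u f [] = 0"
| "prism u f (x # xs) = f (x # map u (x # xs)) - prism u (\<lambda>ys. f (x # ys)) xs"

definition contraction ::
    "'a \<Rightarrow> ('a \<Rightarrow> 'a) \<Rightarrow> ('a list \<Rightarrow> 'b::ab_group_add) \<Rightarrow> 'a list \<Rightarrow> 'b" where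
  "contraction e u f xs = f (e # map u xs) - prism u f xs"

lemma cobd_diff: "cobd (\<lambda>ys. f ys - g ys) xs = cobd f xs - cobd g xs"
  by (induction xs arbitrary: f g) simp_all

lemma cobd_sum: "cobd (\<lambda>ys. \<Sum>i\<in>I. f i ys) xs = (\<Sum>i\<in>I. cobd (f i) xs)"
  by (induction xs arbitrary: f) (simp_all add: sum_subtractf)

lemma cobd_scale:
  fixes c :: "'b::ring"
  shows "cobd (\<lambda>ys. c * f ys) xs = c * cobd f xs"
  by (induction xs arbitrary: f) (simp_all add: right_diff_distrib)

lemma cobd_map: "cobd (\<lambda>ys. f (map g ys)) xs = cobd f (map g xs)"
proof (induction xs arbitrary: f)
  case (Cons x xs)
  show ?case using Cons.IH[of "\<lambda>ys. f (g x # ys)"] by simp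
qed simp

lemma prism_diff: "prism u (\<lambda>ys. f ys - g ys) xs = prism u f xs - prism u g xs"
  by (induction xs arbitrary: f g) simp_all

lemma contraction_diff:
  "contraction e u (\<lambda>ys. f ys - g ys) = (\<lambda>xs. contraction e u f xs - contraction e u g xs)"
  by (auto simp: contraction_def prism_diff)

lemma prism_homotopy:
  "prism u (cobd f) xs + cobd (prism u f) xs = f (map u xs) - f xs"
proof (induction xs arbitrary: f)
  case (Cons x xs)
  have "cobd (\<lambda>ys. f (x # u x # map u ys)) xs = cobd (\<lambda>ys. f (x # u x # ys)) (map u xs)"
    using cobd_map[of "\<lambda>ys. f (x # u x # ys)" u xs] by simp
  then show ?case
    using Cons.IH[of "\<lambda>ys. f (x # ys)"] by (simp add: prism_diff cobd_diff algebra_simps)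
qed simp

lemma contraction_homotopy:
  "contraction e u (cobd f) xs = f xs - cobd (contraction e u f) xs"
proof -
  have "prism u (cobd f) xs = f (map u xs) - f xs - cobd (prism u f) xs"
    using prism_homotopy[of u f xs] by (simp add: eq_diff_eq)
  then show ?thesis
    using cobd_map[of "\<lambda>ys. f (e # ys)" u xs]
    by (simp add: contraction_def[abs_def] cobd_diff)
qed

lemma prism_cong:
  fixes f g :: "'a list \<Rightarrow> 'b::unique_euclidean_ring"
  assumes "\<And>ys x zs. xs = ys @ x # zs \<Longrightarrow>
    [f (ys @ x # map u (x # zs)) = g (ys @ x # map u (x # zs))] (mod m)"
  shows "[prism u f xs = prism u g xs] (mod m)"
  using assms
proof (induction xs arbitrary: f g)
  case (Cons x xs)
  have "[prism u (\<lambda>ys. f (x # ys)) xs = prism u (\<lambda>ys. g (x # ys)) xs] (mod m)"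
  proof (rule Cons.IH)
    fix ys y zs assume "xs = ys @ y # zs"
    then show "[f (x # ys @ y # map u (y # zs)) = g (x # ys @ y # map u (y # zs))] (mod m)"
      using Cons.prems[of "x # ys"] by simp
  qed
  moreover have "[f (x # map u (x # xs)) = g (x # map u (x # xs))] (mod m)"
    using Cons.prems[of "[]"] by simp
  ultimately show ?case by (simp add: cong_diff)
qed simp

section \<open>Cocycles of the cyclic group\<close>

definition descent :: "nat \<Rightarrow> nat \<Rightarrow> int" where
  "descent x y = (if y < x then 1 else 0)"

definition orient :: "nat \<Rightarrow> nat \<Rightarrow> nat \<Rightarrow> int" where
  "orient x y z = descent y z - descent x z + descent x y"

fun cocycle_even :: "nat list \<Rightarrow> int" where
  "cocycle_even (x # y # z # zs) = orient x y z * cocycle_even (z # zs)"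
| "cocycle_even xs = 1"

fun cocycle_odd :: "nat list \<Rightarrow> int" where
  "cocycle_odd (x # y # ys) = (int y - int x) * cocycle_even (y # ys)"
| "cocycle_odd xs = 0"

definition cocycle :: "nat \<Rightarrow> nat list \<Rightarrow> int" where
  "cocycle q = (if even q then cocycle_even else cocycle_odd)"

fun primitive_even :: "nat list \<Rightarrow> int" where
  "primitive_even (x # xs) = int x * cocycle_even (x # xs)"
| "primitive_even [] = 0"

fun primitive_odd :: "nat list \<Rightarrow> int" where
  "primitive_odd (x # y # ys) = descent x y * cocycle_even (y # ys)"
| "primitive_odd xs = 0"

definition primitive :: "nat \<Rightarrow> nat list \<Rightarrow> int" where
  "primitive q = (if even q then primitive_even else primitive_odd)"

lemma cobd_cocycle_even: "even (length xs) \<Longrightarrow> cobd cocycle_even xs = 0"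
proof (induction xs rule: induct_list012)
  case (3 x y zs)
  show ?case
  proof (cases zs)
    case (Cons z zs')
    with 3 obtain w ws where zs: "zs = z # w # ws"
      by (cases zs') auto
    have "cobd cocycle_even (z # w # ws) = 0" using 3 zs by simp
    then have IH: "cobd (\<lambda>ys. cocycle_even (z # ys)) (w # ws) = cocycle_even (w # ws)"
      by simp
    have "cobd (\<lambda>ys. cocycle_even (x # y # z # ys)) (w # ws)
        = orient x y z * cocycle_even (w # ws)"
      using IH by (simp only: cocycle_even.simps cobd_scale)
    then have "cobd cocycle_even (x # y # z # w # ws)
        = (orient y z w - orient x z w + orient x y w - orient x y z) * cocycle_even (w # ws)"
      by (simp only: cobd.simps(2)[of _ x] cobd.simps(2)[of _ y] cobd.simps(2)[of _ z]
          cocycle_even.simps) (simp add: algebra_simps)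
    also have "orient y z w - orient x z w + orient x y w - orient x y z = 0"
      by (simp add: orient_def)
    finally show ?thesis using zs by simp
  qed simp
qed simp_all

lemma cobd_cocycle_even_Cons:
  assumes "odd (length xs)"
  shows "cobd (\<lambda>ys. cocycle_even (x # ys)) xs = cocycle_even xs"
  using cobd_cocycle_even[of "x # xs"] assms by simp

lemma cobd_primitive:
  assumes "length xs = Suc (Suc q)"
  shows "cobd (primitive q) xs = cocycle (Suc q) xs"
proof (cases "even q")
  case True
  obtain x y ys where xs: "xs = x # y # ys"
    using assms by (auto simp: length_Suc_conv)
  have "cobd (\<lambda>zs. int x * cocycle_even (x # zs)) (y # ys) = int x * cocycle_even (y # ys)"
    using assms True xs by (simp only: cobd_scale, subst cobd_cocycle_even_Cons) auto
  then show ?thesis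
    using True xs by (simp add: primitive_def cocycle_def algebra_simps)
next
  case False
  then obtain x y z zs where xs: "xs = x # y # z # zs"
    using assms by (cases q) (auto simp: length_Suc_conv)
  have "cobd (\<lambda>ys. descent x y * cocycle_even (y # ys)) (z # zs)
      = descent x y * cocycle_even (z # zs)"
    using assms False xs by (simp only: cobd_scale, subst cobd_cocycle_even_Cons) auto
  then show ?thesis
    using False xs by (simp add: primitive_def cocycle_def orient_def algebra_simps)
qed

lemma successively_neq_if_cocycle_even_nonzero:
  "cocycle_even xs \<noteq> 0 \<Longrightarrow> odd (length xs) \<Longrightarrow> successively (\<noteq>) xs"
proof (induction xs rule: cocycle_even.induct)
  case (1 x y z zs)
  then have "orient x y z \<noteq> 0" "successively (\<noteq>) (z # zs)" by auto
  then show ?case by (auto simp: orient_def descent_def)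
qed auto

lemma successively_neq_if_cocycle_nonzero:
  assumes "cocycle q xs \<noteq> 0" "length xs = Suc q"
  shows "successively (\<noteq>) xs"
proof (cases "even q")
  case True
  then show ?thesis
    using assms successively_neq_if_cocycle_even_nonzero by (simp add: cocycle_def)
next
  case False
  then obtain x y ys where xs: "xs = x # y # ys"
    using assms by (cases q) (auto simp: length_Suc_conv)
  then show ?thesis
    using assms False successively_neq_if_cocycle_even_nonzero[of "y # ys"]
    by (auto simp: cocycle_def)
qed

section \<open>The cyclic shift\<close>

definition shift :: "nat \<Rightarrow> nat \<Rightarrow> nat" where
  "shift p i = Suc i mod p"

lemma shift_less: "p > 0 \<Longrightarrow> shift p i < p"
  by (simp add: shift_def)

lemma shift_funpow: "i < p \<Longrightarrow> (shift p ^^ j) i = (i + j) mod p"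
  by (induction j) (simp_all add: shift_def mod_Suc_eq)

lemma bij_betw_add_mod: "bij_betw (\<lambda>j. (x + j) mod p) {..<p} {..<p :: nat}"
proof -
  have "inj_on (\<lambda>j. (x + j) mod p) {..<p}"
  proof (rule inj_onI)
    fix i j assume ij: "i \<in> {..<p}" "j \<in> {..<p}" and "(x + i) mod p = (x + j) mod p"
    then have "[i = j] (mod p)" using cong_add_lcancel_nat[of x i j p] by (simp add: cong_def)
    then show "i = j" using ij by (simp add: cong_def)
  qed
  moreover have "(\<lambda>j. (x + j) mod p) ` {..<p} \<subseteq> {..<p}" by auto
  ultimately show ?thesis
    by (simp add: bij_betw_def endo_inj_surj)
qed

lemma bij_betw_shift: "bij_betw (shift p) {..<p} {..<p}"
  using bij_betw_add_mod[of 1 p] by (simp add: shift_def[abs_def])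

lemma inj_on_shift: "B \<subseteq> {..<p} \<Longrightarrow> inj_on (shift p) B"
  using bij_betw_shift[of p] by (auto simp: bij_betw_def intro: inj_on_subset)

lemma descent_shift:
  assumes "x < p" "y < p"
  shows "descent (shift p x) (shift p y)
    = descent x y - (if Suc x = p then 1 else 0) + (if Suc y = p then 1 else 0)"
  using assms by (cases "Suc x = p"; cases "Suc y = p") (auto simp: shift_def descent_def)

lemma orient_shift:
  assumes "x < p" "y < p" "z < p"
  shows "orient (shift p x) (shift p y) (shift p z) = orient x y z"
  using assms by (simp add: orient_def descent_shift)

lemma cocycle_even_shift:
  "set xs \<subseteq> {..<p} \<Longrightarrow> cocycle_even (map (shift p) xs) = cocycle_even xs"
  by (induction xs rule: cocycle_even.induct) (simp_all add: orient_shift)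

lemma cocycle_even_shift_funpow:
  assumes "set xs \<subseteq> {..<p}"
  shows "cocycle_even (map (shift p ^^ j) xs) = cocycle_even xs"
proof (induction j)
  case (Suc j)
  have "set (map (shift p ^^ j) xs) \<subseteq> {..<p}"
    using assms by (auto simp: shift_funpow)
  from cocycle_even_shift[OF this] show ?case
    using Suc by (simp add: comp_def)
qed simp

lemma sum_shift_funpow:
  assumes "x < p"
  shows "(\<Sum>j<p. int ((shift p ^^ j) x)) = (\<Sum>j<p. int j)"
  using sum.reindex_bij_betw[OF bij_betw_add_mod[of x p], of int] assms by (simp add: shift_funpow)

lemma diff_mod_eq_descent:
  assumes "x < p" "y < p"
  shows "(int y - int x) mod int p = int y - int x + int p * descent x y"
proof (cases "y < x")
  case True
  have "(int y - int x) mod int p = (int y - int x + int p) mod int p" by simp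
  also have "\<dots> = int y - int x + int p"
    using True assms by (intro mod_pos_pos_trivial) auto
  finally show ?thesis using True by (simp add: descent_def)
qed (use assms in \<open>simp add: descent_def\<close>)

text \<open>The shift preserves \<open>y - x\<close> modulo \<open>p\<close>, while the differences of the shifted representatives
  sum to zero; the corrections by \<open>p\<close> at the descents make up for this.\<close>

lemma sum_descent_shift:
  assumes "x < p" "y < p"
  shows "(\<Sum>j<p. descent ((shift p ^^ j) x) ((shift p ^^ j) y)) = (int y - int x) mod int p"
    (is "?D = ?d")
proof -
  have difference: "int ((shift p ^^ j) y) - int ((shift p ^^ j) x)
    = ?d - int p * descent ((shift p ^^ j) x) ((shift p ^^ j) y)" for j
  proof -
    have "[int ((y + j) mod p) - int ((x + j) mod p) = int (y + j) - int (x + j)] (mod int p)"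
      unfolding of_nat_mod by (intro cong_diff) simp_all
    then have "?d = (int ((y + j) mod p) - int ((x + j) mod p)) mod int p"
      by (simp add: cong_def)
    then show ?thesis
      using assms diff_mod_eq_descent[of "(x + j) mod p" p "(y + j) mod p"]
      by (simp add: shift_funpow)
  qed
  have "0 = (\<Sum>j<p. int ((shift p ^^ j) y) - int ((shift p ^^ j) x))"
    using assms by (simp add: sum_subtractf sum_shift_funpow)
  also have "\<dots> = int p * ?d - int p * ?D"
    by (simp add: difference sum_subtractf sum_distrib_left)
  finally show ?thesis using assms by simp
qed

text \<open>Odd transfers are $g - 1$ and even ones are the norm $1 + g + \dots + g^{p-1}$, the two
  maps of the periodic resolution of the cyclic group.\<close>

definition transfer ::
    "nat \<Rightarrow> ('a \<Rightarrow> 'a) \<Rightarrow> nat \<Rightarrow> ('a list \<Rightarrow> 'b::ab_group_add) \<Rightarrow> 'a list \<Rightarrow> 'b" where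
  "transfer p g q f xs =
    (if odd q then f (map g xs) - f xs else (\<Sum>j<p. f (map (g ^^ j) xs)))"

lemma transfer_diff:
  "transfer p g q (\<lambda>ys. f ys - f' ys) = (\<lambda>xs. transfer p g q f xs - transfer p g q f' xs)"
  by (auto simp: transfer_def sum_subtractf)

lemma transfer_cobd: "transfer p g q (cobd f) = cobd (transfer p g q f)"
  by (simp add: fun_eq_iff transfer_def[abs_def] cobd_diff cobd_sum cobd_map)

lemma transfer_transfer:
  assumes "map (g ^^ p) xs = xs"
  shows "transfer p g q (transfer p g (Suc q) f) xs = 0"
proof -
  have "map (g ^^ j) (map g xs) = map (g ^^ Suc j) xs" for j
    by (simp add: funpow_swap1)
  moreover have "map g (map (g ^^ j) xs) = map (g ^^ Suc j) xs" for j
    by simp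
  moreover have "(\<Sum>j<p. f (map (g ^^ Suc j) xs) - f (map (g ^^ j) xs)) = 0"
    using sum_lessThan_telescope[of "\<lambda>j. f (map (g ^^ j) xs)" p] assms by simp
  ultimately show ?thesis
    by (simp only: transfer_def) (simp flip: sum_subtractf)
qed

lemma transfer_map:
  assumes "\<And>j. map s (map (g ^^ j) xs) = map (h ^^ j) (map s xs)"
  shows "transfer p g q (\<lambda>ys. f (map s ys)) xs = transfer p h q f (map s xs)"
  using assms assms[of 1] by (simp add: transfer_def del: map_map)

lemma transfer_primitive:
  assumes "length xs = Suc q" "set xs \<subseteq> {..<p}"
  shows "[transfer p (shift p) (Suc q) (primitive q) xs = cocycle q xs] (mod int p)"
proof (cases "even q")
  case True
  obtain x ys where xs: "xs = x # ys" using assms(1) by (auto simp: length_Suc_conv)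
  have "cocycle_even (map (shift p) xs) = cocycle_even xs"
    using assms(2) by (rule cocycle_even_shift)
  then have "transfer p (shift p) (Suc q) (primitive q) xs
      = (int (shift p x) - int x) * cocycle_even xs"
    using True xs by (simp add: transfer_def primitive_def algebra_simps)
  moreover have "[int (shift p x) - int x = int (Suc x) - int x] (mod int p)"
    unfolding shift_def of_nat_mod by (intro cong_diff) simp_all
  then have "[(int (shift p x) - int x) * cocycle_even xs = 1 * cocycle_even xs] (mod int p)"
    by (intro cong_mult) simp_all
  ultimately show ?thesis using True by (simp add: cocycle_def)
next
  case False
  then obtain x y ys where xs: "xs = x # y # ys"
    using assms(1) by (cases q) (auto simp: length_Suc_conv)
  have "cocycle_even (map (shift p ^^ j) (y # ys)) = cocycle_even (y # ys)" for j
    using assms xs by (intro cocycle_even_shift_funpow) auto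
  then have "transfer p (shift p) (Suc q) (primitive q) xs
      = (\<Sum>j<p. descent ((shift p ^^ j) x) ((shift p ^^ j) y)) * cocycle_even (y # ys)"
    using False xs by (simp add: transfer_def primitive_def sum_distrib_right)
  also have "\<dots> = ((int y - int x) mod int p) * cocycle_even (y # ys)"
    using assms xs by (simp add: sum_descent_shift)
  also have "[\<dots> = (int y - int x) * cocycle_even (y # ys)] (mod int p)"
    by (intro cong_mult) simp_all
  finally show ?thesis using False xs by (simp add: cocycle_def)
qed

section \<open>A Tucker lemma for the cyclic group\<close>

text \<open>A point of the join of \<open>card W\<close> copies of the cyclic group is a partial map from \<open>W\<close>
  to \<open>{..<p}\<close>; flags of partial maps are the simplices of its barycentric subdivision, with
  repetitions allowed.\<close>

definition pmaps :: "nat \<Rightarrow> 'a set \<Rightarrow> ('a \<Rightarrow> nat option) set" where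
  "pmaps p W = {X. X \<noteq> Map.empty \<and> dom X \<subseteq> W \<and> ran X \<subseteq> {..<p}}"

definition flags :: "nat \<Rightarrow> 'a set \<Rightarrow> nat \<Rightarrow> ('a \<Rightarrow> nat option) list set" where
  "flags p W q = {xs. length xs = Suc q \<and> sorted_wrt (\<subseteq>\<^sub>m) xs \<and> set xs \<subseteq> pmaps p W}"

definition act :: "nat \<Rightarrow> ('a \<Rightarrow> nat option) \<Rightarrow> 'a \<Rightarrow> nat option" where
  "act p X = map_option (shift p) \<circ> X"

definition equivariant :: "nat \<Rightarrow> 'a set \<Rightarrow> (('a \<Rightarrow> nat option) \<Rightarrow> nat) \<Rightarrow> bool" where
  "equivariant p W s \<longleftrightarrow> (\<forall>X\<in>pmaps p W. s X < p \<and> s (act p X) = shift p (s X))"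

lemma pmaps_mono: "W \<subseteq> W' \<Longrightarrow> pmaps p W \<subseteq> pmaps p W'"
  by (auto simp: pmaps_def)

lemma equivariant_mono: "W \<subseteq> W' \<Longrightarrow> equivariant p W' s \<Longrightarrow> equivariant p W s"
  using pmaps_mono[of W W' p] by (auto simp: equivariant_def)

lemma pmapsE:
  assumes "X \<in> pmaps p W"
  obtains x i where "X x = Some i" "x \<in> W" "i < p"
  using assms by (fastforce simp: pmaps_def fun_eq_iff ran_def dom_def)

lemma act_funpow: "(act p ^^ j) X = map_option (shift p ^^ j) \<circ> X"
  by (induction j) (auto simp: act_def option.map_comp fun_eq_iff comp_def option.map_ident)

lemma act_funpow_self:
  assumes "ran X \<subseteq> {..<p}"
  shows "(act p ^^ p) X = X"
proof
  fix a
  show "(act p ^^ p) X a = X a"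
    using assms by (cases "X a") (auto simp: act_funpow ran_def shift_funpow)
qed

lemma act_in_pmaps:
  assumes "X \<in> pmaps p W"
  shows "act p X \<in> pmaps p W"
proof -
  have "p > 0" using assms by (elim pmapsE) simp
  then have "ran (act p X) \<subseteq> {..<p}" by (auto simp: act_def ran_def shift_less)
  moreover have "dom (act p X) = dom X" by (auto simp: act_def)
  ultimately show ?thesis
    using assms unfolding pmaps_def mem_Collect_eq dom_eq_empty_conv[symmetric] by simp
qed

lemma act_funpow_in_pmaps: "X \<in> pmaps p W \<Longrightarrow> (act p ^^ j) X \<in> pmaps p W"
  by (induction j) (auto simp: act_in_pmaps)

lemma equivariant_act_funpow:
  assumes "equivariant p W s" "X \<in> pmaps p W"
  shows "s ((act p ^^ j) X) = (shift p ^^ j) (s X)"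
  using assms by (induction j) (auto simp: equivariant_def act_funpow_in_pmaps)

lemma act_funpow_mono: "X \<subseteq>\<^sub>m Y \<Longrightarrow> (act p ^^ j) X \<subseteq>\<^sub>m (act p ^^ j) Y"
  by (auto simp: act_funpow map_le_def dom_def)

lemma map_act_funpow_in_flags:
  assumes "xs \<in> flags p W q"
  shows "map (act p ^^ j) xs \<in> flags p W q"
proof -
  have "sorted_wrt (\<lambda>X Y. (act p ^^ j) X \<subseteq>\<^sub>m (act p ^^ j) Y) xs"
    using assms by (auto simp: flags_def act_funpow_mono elim!: sorted_wrt_mono_rel[rotated])
  then show ?thesis
    using assms by (auto simp: flags_def sorted_wrt_map act_funpow_in_pmaps)
qed

lemma map_act_funpow_self: "xs \<in> flags p W q \<Longrightarrow> map (act p ^^ p) xs = xs"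
  by (intro map_idI act_funpow_self) (auto simp: flags_def pmaps_def)

lemma transfer_cong:
  fixes f g :: "_ \<Rightarrow> 'b::unique_euclidean_ring"
  assumes "xs \<in> flags p W q" and "\<And>ys. ys \<in> flags p W q \<Longrightarrow> [f ys = g ys] (mod m)"
  shows "[transfer p (act p) k f xs = transfer p (act p) k g xs] (mod m)"
proof -
  have "[f (map (act p ^^ j) xs) = g (map (act p ^^ j) xs)] (mod m)" for j
    using assms map_act_funpow_in_flags by blast
  from this[of 0] this[of 1] this show ?thesis
    by (simp add: transfer_def cong_diff cong_sum)
qed

lemma cone_in_pmaps:
  assumes "p > 0" "X = Map.empty \<or> X \<in> pmaps p W"
  shows "X(x \<mapsto> 0) \<in> pmaps p (insert x W)"
  using assms by (auto simp: pmaps_def ran_def split: if_splits)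

lemma cone_in_flags:
  assumes "xs \<in> flags p W q"
  shows "[x \<mapsto> 0] # map (\<lambda>X. X(x \<mapsto> 0)) xs \<in> flags p (insert x W) (Suc q)"
proof -
  have xs: "length xs = Suc q" "sorted_wrt (\<subseteq>\<^sub>m) xs" "set xs \<subseteq> pmaps p W"
    using assms by (auto simp: flags_def)
  then obtain X where "X \<in> pmaps p W" by (cases xs) auto
  then have "p > 0" by (elim pmapsE) simp
  have "sorted_wrt (\<lambda>X Y. X(x \<mapsto> 0) \<subseteq>\<^sub>m Y(x \<mapsto> 0)) xs"
    using xs(2) by (rule sorted_wrt_mono_rel[rotated]) (rule map_le_upd)
  moreover have "X(x \<mapsto> 0) \<in> pmaps p (insert x W)" if "X = Map.empty \<or> X \<in> set xs" for X
    using that xs(3) \<open>p > 0\<close> by (intro cone_in_pmaps) auto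
  ultimately show ?thesis
    using xs(1) by (auto simp: flags_def sorted_wrt_map map_le_def)
qed

lemma prism_in_flags:
  assumes "x \<notin> W" "ys @ X # zs \<in> flags p W q"
  shows "ys @ X # map (\<lambda>X. X(x \<mapsto> 0)) (X # zs) \<in> flags p (insert x W) (Suc q)"
proof -
  let ?cone = "\<lambda>X. X(x \<mapsto> 0)"
  have "[x \<mapsto> 0] # map ?cone (ys @ X # zs) \<in> flags p (insert x W) (Suc q)"
    using assms(2) by (rule cone_in_flags)
  moreover have "Y \<subseteq>\<^sub>m ?cone Z" if "Y \<subseteq>\<^sub>m Z" "Y \<in> pmaps p W" for Y Z
  proof -
    have "x \<notin> dom Y" using that(2) assms(1) by (auto simp: pmaps_def)
    then show ?thesis using that(1) by (auto simp: map_le_def)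
  qed
  ultimately show ?thesis
    using assms(2) pmaps_mono[OF subset_insertI, of p W x]
    by (auto simp: flags_def sorted_wrt_append)
qed

abbreviation coning :: "'a \<Rightarrow> (('a \<Rightarrow> nat option) list \<Rightarrow> 'b::ab_group_add)
    \<Rightarrow> ('a \<Rightarrow> nat option) list \<Rightarrow> 'b" where
  "coning x \<equiv> contraction [x \<mapsto> 0] (\<lambda>X. X(x \<mapsto> 0))"

lemma coning_cong:
  fixes f g :: "_ \<Rightarrow> 'b::unique_euclidean_ring"
  assumes "x \<notin> W" "xs \<in> flags p W q"
    and "\<And>ys. ys \<in> flags p (insert x W) (Suc q) \<Longrightarrow> [f ys = g ys] (mod m)"
  shows "[coning x f xs = coning x g xs] (mod m)"
  unfolding contraction_def
proof (intro cong_diff prism_cong)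
  show "[f ([x \<mapsto> 0] # map (\<lambda>X. X(x \<mapsto> 0)) xs) = g ([x \<mapsto> 0] # map (\<lambda>X. X(x \<mapsto> 0)) xs)] (mod m)"
    using assms(2) by (intro assms(3) cone_in_flags)
next
  fix ys X zs assume "xs = ys @ X # zs"
  then show "[f (ys @ X # map (\<lambda>X. X(x \<mapsto> 0)) (X # zs))
      = g (ys @ X # map (\<lambda>X. X(x \<mapsto> 0)) (X # zs))] (mod m)"
    using assms(1,2) by (intro assms(3) prism_in_flags) simp_all
qed

text \<open>\<open>evaluate p c q\<close> pairs a cochain with the \<open>q\<close>-chain \<open>h\<^sub>q\<close> determined by coning:
  \<open>h\<^sub>0\<close> is a vertex and \<open>h\<^sub>q\<close> fills the cycle obtained from \<open>h\<^bsub>q - 1\<^esub>\<close> by transfer.\<close>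

primrec evaluate ::
    "nat \<Rightarrow> (nat \<Rightarrow> 'a) \<Rightarrow> nat \<Rightarrow> (('a \<Rightarrow> nat option) list \<Rightarrow> 'b::ab_group_add) \<Rightarrow> 'b" where
  "evaluate p c 0 f = f [[c 0 \<mapsto> 0]]"
| "evaluate p c (Suc q) f =
    evaluate p c q (transfer p (act p) (Suc q) (coning (c (Suc q)) f))"

lemma evaluate_diff:
  "evaluate p c q (\<lambda>ys. f ys - g ys) = evaluate p c q f - evaluate p c q g"
  by (induction q arbitrary: f g) (simp_all add: transfer_diff contraction_diff)

lemma evaluate_zero: "evaluate p c q (\<lambda>_. 0) = 0"
  using evaluate_diff[of p c q "\<lambda>_. 0" "\<lambda>_. 0"] by simp

lemma evaluate_cong:
  fixes f g :: "_ \<Rightarrow> 'b::unique_euclidean_ring"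
  assumes "inj_on c {..q}" "p > 0"
    and "\<And>xs. xs \<in> flags p (c ` {..q}) q \<Longrightarrow> [f xs = g xs] (mod m)"
  shows "[evaluate p c q f = evaluate p c q g] (mod m)"
  using assms
proof (induction q arbitrary: f g)
  case 0
  have "[[c 0 \<mapsto> 0]] \<in> flags p (c ` {..0}) 0"
    using cone_in_pmaps[of p Map.empty "{}" "c 0"] 0(2) by (simp add: flags_def)
  then show ?case using 0 by simp
next
  case (Suc q)
  have "inj_on c {..q}" "c (Suc q) \<notin> c ` {..q}"
    using Suc.prems(1) by (auto simp: atMost_Suc)
  with Suc.prems show ?case
    unfolding evaluate.simps atMost_Suc image_insert
    by (intro Suc.IH transfer_cong[where W = "c ` {..q}" and q = q]
        coning_cong[where W = "c ` {..q}"]) simp_all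
qed

text \<open>Stokes' theorem: the boundary of \<open>h\<^bsub>q + 1\<^esub>\<close> is the transfer of \<open>h\<^sub>q\<close>.\<close>

lemma evaluate_cobd:
  fixes f :: "_ \<Rightarrow> 'b::unique_euclidean_ring"
  assumes "inj_on c {..Suc q}" "p > 0"
  shows "[evaluate p c (Suc q) (cobd f) = evaluate p c q (transfer p (act p) (Suc q) f)] (mod m)"
  using assms
proof (induction q arbitrary: f)
  case 0
  have "evaluate p c (Suc 0) (cobd f) = evaluate p c 0 (transfer p (act p) (Suc 0) f)
      - cobd (transfer p (act p) (Suc 0) (coning (c (Suc 0)) f)) [[c 0 \<mapsto> 0]]"
    by (simp only: evaluate.simps contraction_homotopy[abs_def] transfer_diff transfer_cobd)
  then show ?case by (simp add: transfer_def[abs_def])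
next
  case (Suc q)
  let ?T = "transfer p (act p)"
  let ?g = "?T (Suc (Suc q)) (coning (c (Suc (Suc q))) f)"
  have inj: "inj_on c {..Suc q}" "inj_on c {..q}"
    using Suc.prems(1) by (simp_all add: atMost_Suc)
  have "[evaluate p c (Suc q) (cobd ?g) = evaluate p c q (?T (Suc q) ?g)] (mod m)"
    using inj Suc.prems by (intro Suc.IH)
  also have "[evaluate p c q (?T (Suc q) ?g) = evaluate p c q (\<lambda>_. 0)] (mod m)"
  proof (rule evaluate_cong[OF inj(2) Suc.prems(2)])
    fix xs assume "xs \<in> flags p (c ` {..q}) q"
    then have "?T (Suc q) ?g xs = 0" by (intro transfer_transfer map_act_funpow_self)
    then show "[?T (Suc q) ?g xs = 0] (mod m)" by simp
  qed
  finally have vanish: "[evaluate p c (Suc q) (cobd ?g) = 0] (mod m)"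
    by (simp only: evaluate_zero)
  have "evaluate p c (Suc (Suc q)) (cobd f)
      = evaluate p c (Suc q) (?T (Suc (Suc q)) f) - evaluate p c (Suc q) (cobd ?g)"
    by (subst evaluate.simps(2))
      (simp only: contraction_homotopy[abs_def] transfer_diff transfer_cobd evaluate_diff)
  then show ?case
    using cong_diff[OF cong_refl vanish] by (simp only: diff_zero)
qed

lemma transfer_act_primitive:
  assumes "equivariant p W s" "xs \<in> flags p W q"
  shows "[transfer p (act p) (Suc q) (\<lambda>ys. primitive q (map s ys)) xs
    = cocycle q (map s xs)] (mod int p)"
proof -
  have "map s (map (act p ^^ j) xs) = map (shift p ^^ j) (map s xs)" for j
    using assms(2) equivariant_act_funpow[OF assms(1)] by (auto simp: flags_def)
  then have "transfer p (act p) (Suc q) (\<lambda>ys. primitive q (map s ys)) xs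
      = transfer p (shift p) (Suc q) (primitive q) (map s xs)"
    by (rule transfer_map)
  also have "[\<dots> = cocycle q (map s xs)] (mod int p)"
    using assms by (intro transfer_primitive) (auto simp: flags_def equivariant_def)
  finally show ?thesis .
qed

lemma evaluate_cocycle:
  assumes "inj_on c {..q}" "p > 0" "equivariant p (c ` {..q}) s"
  shows "[evaluate p c q (\<lambda>xs. cocycle q (map s xs)) = 1] (mod int p)"
  using assms
proof (induction q)
  case 0
  then show ?case by (simp add: cocycle_def)
next
  case (Suc q)
  let ?f = "\<lambda>ys. primitive q (map s ys)"
  have inj: "inj_on c {..q}"
    using Suc.prems(1) by (simp_all add: atMost_Suc)
  have s: "equivariant p (c ` {..q}) s"
    using Suc.prems(3) by (rule equivariant_mono[rotated]) auto
  have "cocycle (Suc q) (map s xs) = cobd ?f xs" if "xs \<in> flags p (c ` {..Suc q}) (Suc q)" for xs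
    using that by (simp add: cobd_map cobd_primitive flags_def)
  then have "[evaluate p c (Suc q) (\<lambda>xs. cocycle (Suc q) (map s xs))
      = evaluate p c (Suc q) (cobd ?f)] (mod int p)"
    using Suc.prems by (intro evaluate_cong) auto
  also have "[evaluate p c (Suc q) (cobd ?f)
      = evaluate p c q (transfer p (act p) (Suc q) ?f)] (mod int p)"
    using Suc.prems by (intro evaluate_cobd)
  also have "[evaluate p c q (transfer p (act p) (Suc q) ?f)
      = evaluate p c q (\<lambda>xs. cocycle q (map s xs))] (mod int p)"
    using inj Suc.prems(2) s by (intro evaluate_cong transfer_act_primitive)
  also have "[evaluate p c q (\<lambda>xs. cocycle q (map s xs)) = 1] (mod int p)"
    using inj Suc.prems(2) s by (rule Suc.IH)
  finally show ?case .
qed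

lemma cocycle_eq_zero_if_few_ranks:
  fixes \<rho> :: "('a \<Rightarrow> nat option) \<Rightarrow> 'b::linorder"
  assumes "xs \<in> flags p V q" "finite R" "card R \<le> q" "\<rho> ` pmaps p V \<subseteq> R"
    and mono: "\<And>X Y. X \<in> pmaps p V \<Longrightarrow> Y \<in> pmaps p V \<Longrightarrow> X \<subseteq>\<^sub>m Y \<Longrightarrow> \<rho> X \<le> \<rho> Y"
    and sign: "\<And>X Y. X \<in> pmaps p V \<Longrightarrow> Y \<in> pmaps p V \<Longrightarrow> X \<subseteq>\<^sub>m Y \<Longrightarrow> \<rho> X = \<rho> Y \<Longrightarrow> s X = s Y"
  shows "cocycle q (map s xs) = 0"
proof (rule ccontr)
  have xs: "length xs = Suc q" "sorted_wrt (\<subseteq>\<^sub>m) xs" "set xs \<subseteq> pmaps p V"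
    using assms(1) by (auto simp: flags_def)
  assume "cocycle q (map s xs) \<noteq> 0"
  then have "successively (\<lambda>X Y. s X \<noteq> s Y) xs"
    using successively_neq_if_cocycle_nonzero[of q "map s xs"] xs(1)
    by (simp add: successively_map)
  with successively_if_sorted_wrt[OF xs(2)] xs(3)
  have "successively (\<lambda>X Y. \<rho> X < \<rho> Y) xs"
  proof (induction xs rule: induct_list012)
    case (3 X Y zs)
    then have "\<rho> X \<le> \<rho> Y" "\<rho> X \<noteq> \<rho> Y" using mono sign by auto
    then show ?case using 3 by auto
  qed auto
  then have "sorted_wrt (<) (map \<rho> xs)"
    by (simp add: successively_map flip: successively_conv_sorted_wrt)
  then have "distinct (map \<rho> xs)" by (simp add: strict_sorted_iff)
  then have "card (\<rho> ` set xs) = Suc q"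
    using distinct_card xs(1) by fastforce
  moreover have "card (\<rho> ` set xs) \<le> card R"
    using xs(3) assms(2,4) by (intro card_mono) auto
  ultimately show False using \<open>card R \<le> q\<close> by simp
qed

theorem cyclic_Tucker:
  fixes \<rho> :: "('a \<Rightarrow> nat option) \<Rightarrow> 'b::linorder"
  assumes "finite V" "p \<ge> 2" "equivariant p V s" "finite R" "\<rho> ` pmaps p V \<subseteq> R"
    and mono: "\<And>X Y. X \<in> pmaps p V \<Longrightarrow> Y \<in> pmaps p V \<Longrightarrow> X \<subseteq>\<^sub>m Y \<Longrightarrow> \<rho> X \<le> \<rho> Y"
    and sign: "\<And>X Y. X \<in> pmaps p V \<Longrightarrow> Y \<in> pmaps p V \<Longrightarrow> X \<subseteq>\<^sub>m Y \<Longrightarrow> \<rho> X = \<rho> Y \<Longrightarrow> s X = s Y"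
  shows "card V \<le> card R"
proof (rule ccontr)
  define q where "q = card R"
  assume "\<not> card V \<le> card R"
  moreover obtain c where "bij_betw c {0..<card V} V"
    using ex_bij_betw_nat_finite[OF \<open>finite V\<close>] by blast
  ultimately have inj: "inj_on c {..q}" and sub: "c ` {..q} \<subseteq> V"
    by (auto simp: q_def bij_betw_def intro: inj_on_subset)
  have "cocycle q (map s xs) = 0" if "xs \<in> flags p (c ` {..q}) q" for xs
  proof (rule cocycle_eq_zero_if_few_ranks[OF _ assms(4) _ assms(5) mono sign])
    show "xs \<in> flags p V q" using that pmaps_mono[OF sub] by (auto simp: flags_def)
  qed (simp_all add: q_def)
  then have "[evaluate p c q (\<lambda>xs. cocycle q (map s xs)) = evaluate p c q (\<lambda>_. 0)] (mod int p)"
    using inj \<open>p \<ge> 2\<close> by (intro evaluate_cong) auto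
  moreover have "[evaluate p c q (\<lambda>xs. cocycle q (map s xs)) = 1] (mod int p)"
    using inj \<open>p \<ge> 2\<close> equivariant_mono[OF sub assms(3)] by (intro evaluate_cocycle) auto
  ultimately have "[0 = 1] (mod int p)"
    by (metis cong_sym cong_trans evaluate_zero)
  then show False using \<open>p \<ge> 2\<close> by (simp add: cong_def)
qed

section \<open>Equivariant signs\<close>

definition fibre :: "('a \<Rightarrow> nat option) \<Rightarrow> nat \<Rightarrow> 'a set" where
  "fibre X i = {x. X x = Some i}"

lemma fibre_act:
  assumes "ran X \<subseteq> {..<p}" "i < p"
  shows "fibre (act p X) (shift p i) = fibre X i"
proof -
  have "shift p j = shift p i \<longleftrightarrow> j = i" if "X x = Some j" for x j
  proof -
    have "j < p" using that assms(1) by (auto simp: ran_def)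
    then show ?thesis using inj_on_eq_iff[OF inj_on_shift[OF order_refl]] assms(2) by simp
  qed
  then show ?thesis by (auto simp: fibre_def act_def)
qed

lemma disjoint_family_on_fibre: "disjoint_family_on (fibre X) I"
  by (auto simp: disjoint_family_on_def fibre_def)

lemma fibre_mono: "X \<subseteq>\<^sub>m Y \<Longrightarrow> fibre X i \<subseteq> fibre Y i"
  by (force simp: fibre_def map_le_def dom_def)

lemma fibre_subset: "X \<in> pmaps p V \<Longrightarrow> fibre X i \<subseteq> V"
  by (auto simp: fibre_def pmaps_def)

lemma map_eq_if_fibre_eq:
  assumes "ran X \<subseteq> {..<p}" "ran Y \<subseteq> {..<p}" "\<And>i. i < p \<Longrightarrow> fibre X i = fibre Y i"
  shows "X = Y"
proof
  fix x
  have "X x = Some i \<longleftrightarrow> Y x = Some i" for i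
    using assms by (cases "i < p") (auto simp: ran_def fibre_def set_eq_iff)
  then show "X x = Y x" by (metis option.exhaust)
qed

definition proper :: "nat \<Rightarrow> nat set \<Rightarrow> bool" where
  "proper p B \<longleftrightarrow> B \<noteq> {} \<and> B \<subset> {..<p}"

text \<open>Dividing by \<open>card B\<close> modulo the prime \<open>p\<close> is what makes the average equivariant.\<close>

definition average :: "nat \<Rightarrow> nat set \<Rightarrow> nat" where
  "average p B = nat (modular_inverse (int p) (int (card B))) * \<Sum>B mod p"

lemma proper_shift_image:
  assumes "B \<subseteq> {..<p}"
  shows "proper p (shift p ` B) \<longleftrightarrow> proper p B"
proof -
  have image: "shift p ` {..<p} = {..<p}"
    using bij_betw_shift by (simp add: bij_betw_def)
  have "shift p ` B = shift p ` {..<p} \<longleftrightarrow> B = {..<p}"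
    using assms by (intro inj_on_image_eq_iff[OF inj_on_shift[OF order_refl]]) auto
  moreover have "shift p ` B \<subseteq> shift p ` {..<p}"
    using assms by (rule image_mono)
  ultimately show ?thesis using assms image by (auto simp: proper_def)
qed

lemma coprime_card_proper:
  assumes "prime p" "proper p B"
  shows "coprime (card B) p"
proof -
  have "card B < p"
    using assms(2) psubset_card_mono[of "{..<p}" B] by (simp add: proper_def)
  moreover have "0 < card B"
    using assms(2) finite_subset[of B "{..<p}"] by (auto simp: proper_def card_gt_0_iff)
  ultimately show ?thesis
    using assms(1) by (metis coprime_commute dvd_imp_le leD prime_imp_coprime)
qed

lemma average_shift_image:
  assumes "prime p" "proper p B"
  shows "average p (shift p ` B) = shift p (average p B)"
proof -
  define u where "u = nat (modular_inverse (int p) (int (card B)))"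
  have inj: "inj_on (shift p) B"
    using assms(2) by (intro inj_on_shift) (auto simp: proper_def)
  have "[int (card B) * int u = 1] (mod int p)"
    using assms prime_gt_0_nat[OF assms(1)] coprime_card_proper
    by (simp add: u_def modular_inverse_int_nonneg cong_modular_inverse1)
  then have u: "[card B * u = 1] (mod p)"
    by (simp flip: cong_int_iff)
  have "[(\<Sum>b\<in>B. shift p b) = (\<Sum>b\<in>B. b + 1)] (mod p)"
    by (intro cong_sum) (simp add: shift_def)
  then have "[u * (\<Sum>b\<in>B. shift p b) = u * (\<Sum>B + card B)] (mod p)"
    by (intro cong_mult) (simp_all only: sum.distrib cong_refl card_eq_sum)
  also have "u * (\<Sum>B + card B) = u * \<Sum>B + card B * u"
    by (simp add: algebra_simps)
  also have "[u * \<Sum>B + card B * u = u * \<Sum>B + 1] (mod p)"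
    using u by (intro cong_add) simp_all
  finally have "u * \<Sum>(shift p ` B) mod p = (u * \<Sum>B + 1) mod p"
    by (simp add: cong_def sum.reindex[OF inj])
  moreover have "average p (shift p ` B) = u * \<Sum>(shift p ` B) mod p"
    "average p B = u * \<Sum>B mod p"
    by (simp_all only: average_def card_image[OF inj] u_def)
  ultimately show ?thesis
    by (simp add: shift_def mod_Suc_eq)
qed

definition selected :: "nat \<Rightarrow> ('i \<Rightarrow> 'a set \<Rightarrow> bool) \<Rightarrow> ('a \<Rightarrow> nat option) \<Rightarrow> 'i \<Rightarrow> nat set" where
  "selected p Q X j = {i. i < p \<and> Q j (fibre X i)}"

definition decisive :: "nat \<Rightarrow> ('i \<Rightarrow> 'a set \<Rightarrow> bool) \<Rightarrow> ('a \<Rightarrow> nat option) \<Rightarrow> bool" where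
  "decisive p Q X \<longleftrightarrow> (\<exists>j. proper p (selected p Q X j))"

definition family_sign :: "nat \<Rightarrow> ('i \<Rightarrow> 'a set \<Rightarrow> bool) \<Rightarrow> ('a \<Rightarrow> nat option) \<Rightarrow> nat" where
  "family_sign p Q X = average p (selected p Q X (SOME j. proper p (selected p Q X j)))"

lemma selected_subset: "selected p Q X j \<subseteq> {..<p}"
  by (auto simp: selected_def)

lemma finite_selected: "finite (selected p Q X j)"
  by (simp add: selected_def)

lemma selected_mono:
  assumes "X \<subseteq>\<^sub>m Y" "\<And>B C. B \<subseteq> C \<Longrightarrow> Q j B \<Longrightarrow> Q j C"
  shows "selected p Q X j \<subseteq> selected p Q Y j"
  using assms(2)[OF fibre_mono[OF assms(1)]] by (auto simp: selected_def)

lemma selected_act: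
  assumes "ran X \<subseteq> {..<p}"
  shows "selected p Q (act p X) j = shift p ` selected p Q X j"
proof -
  have "selected p Q (act p X) j = {i \<in> shift p ` {..<p}. Q j (fibre (act p X) i)}"
    using bij_betw_shift[of p] by (auto simp: selected_def bij_betw_def)
  also have "\<dots> = shift p ` {i \<in> {..<p}. Q j (fibre (act p X) (shift p i))}"
    by (rule Compr_image_eq)
  also have "\<dots> = shift p ` selected p Q X j"
    using fibre_act[OF assms]
    by (intro arg_cong[where f = "image (shift p)"]) (auto simp: selected_def)
  finally show ?thesis .
qed

lemma proper_selected_act:
  "ran X \<subseteq> {..<p} \<Longrightarrow> proper p (selected p Q (act p X) j) \<longleftrightarrow> proper p (selected p Q X j)"
  by (simp add: selected_act proper_shift_image[OF selected_subset])

lemma decisive_act: "ran X \<subseteq> {..<p} \<Longrightarrow> decisive p Q (act p X) \<longleftrightarrow> decisive p Q X"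
  by (simp add: decisive_def proper_selected_act)

lemma family_sign_less: "p > 0 \<Longrightarrow> family_sign p Q X < p"
  by (simp add: family_sign_def average_def)

lemma family_sign_act:
  assumes "prime p" "ran X \<subseteq> {..<p}" "decisive p Q X"
  shows "family_sign p Q (act p X) = shift p (family_sign p Q X)"
proof -
  have "proper p (selected p Q X (SOME j. proper p (selected p Q X j)))"
    using assms(3) unfolding decisive_def by (rule someI_ex)
  with assms(1) show ?thesis
    unfolding family_sign_def proper_selected_act[OF assms(2)]
    unfolding selected_act[OF assms(2)]
    by (rule average_shift_image)
qed

lemma const_on_fibres_if_not_decisive:
  fixes h :: "'a set \<Rightarrow> 'b::linorder"
  assumes "\<not> decisive p (\<lambda>l B. l \<le> h B) X" "i < p" "j < p"
  shows "h (fibre X i) = h (fibre X j)"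
proof -
  have "h (fibre X i) \<le> h (fibre X j)" if "i < p" "j < p" for i j
  proof (rule ccontr)
    let ?S = "selected p (\<lambda>l B. l \<le> h B) X (h (fibre X i))"
    assume "\<not> h (fibre X i) \<le> h (fibre X j)"
    then have "i \<in> ?S" "j \<in> {..<p}" "j \<notin> ?S" using that by (auto simp: selected_def)
    then have "proper p ?S" using selected_subset unfolding proper_def by fast
    then show False using assms(1) by (auto simp: decisive_def)
  qed
  with assms(2,3) show ?thesis by (intro antisym)
qed

lemma decisive_member:
  assumes "X \<in> pmaps p V" "p \<ge> 2"
  shows "decisive p (\<in>) X"
proof -
  obtain x i where x: "X x = Some i" "i < p" using assms(1) by (rule pmapsE)
  then have "selected p (\<in>) X x = {i}" by (auto simp: selected_def fibre_def)
  moreover have "card {i} \<noteq> card {..<p}" using assms(2) by simp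
  then have "{i} \<noteq> {..<p}" by metis
  ultimately have "proper p (selected p (\<in>) X x)" using x(2) by (simp add: proper_def psubset_eq)
  then show ?thesis by (auto simp: decisive_def)
qed

section \<open>Kneser hypergraphs\<close>

definition kneser :: "nat \<Rightarrow> 'a set set \<Rightarrow> 'a set hypergraph" where
  "kneser r \<F> = (\<F>, {e. e \<subseteq> \<F> \<and> card e = r \<and> pairwise disjnt e})"

definition colorable :: "'a hypergraph \<Rightarrow> nat \<Rightarrow> bool" where
  "colorable H m \<longleftrightarrow> (\<exists>c. is_coloring H m c)"

lemma verts_kneser: "verts (kneser r \<F>) = \<F>"
  by (simp add: verts_def kneser_def)

lemma in_hyperedges_kneser_iff:
  "e \<in> hyperedges (kneser r \<F>) \<longleftrightarrow> e \<subseteq> \<F> \<and> card e = r \<and> pairwise disjnt e"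
  by (simp add: hyperedges_def kneser_def)

lemma chromatic_number_eq_if_colorable_iff:
  assumes "\<And>m. colorable H m \<longleftrightarrow> M \<le> m"
  shows "chromatic_number H = M"
  using assms by (auto simp: chromatic_number_def colorable_def intro: Least_equality)

lemma image_in_hyperedges_kneser:
  assumes "disjoint_family_on S I" "\<And>i. i \<in> I \<Longrightarrow> S i \<in> \<F>" "{} \<notin> \<F>"
  shows "S ` I \<in> hyperedges (kneser (card I) \<F>)"
proof -
  have "inj_on S I"
    using assms by (intro inj_onI) (metis disjoint_family_onD inf.idem)
  then show ?thesis
    using assms(2) disjoint_family_onD[OF assms(1)]
    by (auto simp: in_hyperedges_kneser_iff card_image pairwise_image pairwise_def disjnt_def)
qed

lemma UN_in_hyperedges_kneser:
  assumes \<M>: "\<M> \<in> hyperedges (kneser p \<G>)"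
    and E: "\<And>S. S \<in> \<M> \<Longrightarrow> E S \<in> hyperedges (kneser d {T \<in> \<F>. T \<subseteq> S})"
    and "{} \<notin> \<F>" "p > 0" "d > 0"
  shows "(\<Union>S\<in>\<M>. E S) \<in> hyperedges (kneser (p * d) \<F>)"
proof -
  have \<M>_disjoint: "S \<inter> S' = {}" if "S \<in> \<M>" "S' \<in> \<M>" "S \<noteq> S'" for S S'
    using \<M> that by (auto simp: in_hyperedges_kneser_iff pairwise_def disjnt_def)
  have E_below: "T \<in> \<F>" "T \<subseteq> S" if "S \<in> \<M>" "T \<in> E S" for S T
    using E[OF that(1)] that(2) by (auto simp: in_hyperedges_kneser_iff)
  have cross: "T \<inter> T' = {}" if "S \<in> \<M>" "S' \<in> \<M>" "S \<noteq> S'" "T \<in> E S" "T' \<in> E S'" for S S' T T'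
    using \<M>_disjoint[OF that(1-3)] E_below[OF that(1,4)] E_below[OF that(2,5)] by blast
  have "disjoint_family_on E \<M>"
    unfolding disjoint_family_on_def
  proof (intro ballI impI)
    fix S S' assume S: "S \<in> \<M>" "S' \<in> \<M>" "S \<noteq> S'"
    have "T = {}" if "T \<in> E S \<inter> E S'" for T using cross[OF S] that by blast
    then show "E S \<inter> E S' = {}" using E_below(1)[OF S(1)] \<open>{} \<notin> \<F>\<close> by blast
  qed
  moreover have "finite \<M>" "\<And>S. S \<in> \<M> \<Longrightarrow> finite (E S)"
    using \<M> E \<open>p > 0\<close> \<open>d > 0\<close> by (auto simp: in_hyperedges_kneser_iff intro: card_ge_0_finite)
  ultimately have "card (\<Union>S\<in>\<M>. E S) = (\<Sum>S\<in>\<M>. card (E S))"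
    by (intro card_UN_disjoint')
  also have "\<dots> = p * d"
    using \<M> E by (simp add: in_hyperedges_kneser_iff)
  finally have "card (\<Union>S\<in>\<M>. E S) = p * d" .
  moreover have "disjnt T T'"
    if T: "S \<in> \<M>" "T \<in> E S" and T': "S' \<in> \<M>" "T' \<in> E S'" and "T \<noteq> T'" for S S' T T'
  proof (cases "S = S'")
    case True
    then show ?thesis
      using E[OF T(1)] T T' \<open>T \<noteq> T'\<close> by (auto simp: in_hyperedges_kneser_iff pairwise_def)
  next
    case False
    then show ?thesis using cross T T' by (simp add: disjnt_def)
  qed
  ultimately show ?thesis
    using E_below(1) by (auto simp: in_hyperedges_kneser_iff pairwise_def)
qed

lemma ex_monochromatic_hyperedge:
  assumes "\<not> colorable H m" "\<And>v. v \<in> verts H \<Longrightarrow> c v \<in> {1..m}"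
  shows "\<exists>e i. e \<in> hyperedges H \<and> (\<forall>v\<in>e. c v = i)"
  using assms unfolding colorable_def is_coloring_def monochromatic_def by blast

lemma ex_monochromatic_hyperedge_kneser:
  assumes "\<not> colorable (kneser r \<F>) m" "r > 0" "\<And>S. S \<in> \<F> \<Longrightarrow> c S \<in> {1..m}"
  shows "\<exists>e i. e \<in> hyperedges (kneser r \<F>) \<and> (\<forall>S\<in>e. c S = i) \<and> i \<in> {1..m}"
proof -
  have "\<exists>e i. e \<in> hyperedges (kneser r \<F>) \<and> (\<forall>S\<in>e. c S = i)"
    using assms(3) by (intro ex_monochromatic_hyperedge[OF assms(1)]) (simp add: verts_kneser)
  then obtain e i where e: "e \<in> hyperedges (kneser r \<F>)" "\<forall>S\<in>e. c S = i"
    by blast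
  then have "e \<subseteq> \<F>" "e \<noteq> {}"
    using \<open>r > 0\<close> by (auto simp: in_hyperedges_kneser_iff)
  then obtain S where "S \<in> e" "S \<in> \<F>" by blast
  then have "i \<in> {1..m}" using assms(3)[of S] e(2) by simp
  with e show ?thesis by blast
qed

lemma not_colorable_kneser_mult:
  assumes \<G>: "\<not> colorable (kneser p \<G>) m"
    and \<F>: "\<And>S. S \<in> \<G> \<Longrightarrow> \<not> colorable (kneser d {T \<in> \<F>. T \<subseteq> S}) m"
    and "{} \<notin> \<F>" "p > 0" "d > 0"
  shows "\<not> colorable (kneser (p * d) \<F>) m"
proof
  assume "colorable (kneser (p * d) \<F>) m"
  then obtain c where c: "is_coloring (kneser (p * d) \<F>) m c"
    unfolding colorable_def by blast
  then have "c T \<in> {1..m}" if "T \<in> \<F>" for T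
    using that by (simp add: is_coloring_def verts_kneser)
  then have "\<forall>S\<in>\<G>. \<exists>e i.
      e \<in> hyperedges (kneser d {T \<in> \<F>. T \<subseteq> S}) \<and> (\<forall>T\<in>e. c T = i) \<and> i \<in> {1..m}"
    using \<F> \<open>d > 0\<close> by (intro ballI ex_monochromatic_hyperedge_kneser) simp_all
  then obtain E c' where E: "\<forall>S\<in>\<G>.
      E S \<in> hyperedges (kneser d {T \<in> \<F>. T \<subseteq> S}) \<and> (\<forall>T\<in>E S. c T = c' S) \<and> c' S \<in> {1..m}"
    unfolding bchoice_iff by (elim exE)
  have "c' S \<in> {1..m}" if "S \<in> \<G>" for S using E that by blast
  then have "\<exists>\<M> i. \<M> \<in> hyperedges (kneser p \<G>) \<and> (\<forall>S\<in>\<M>. c' S = i)"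
    by (intro ex_monochromatic_hyperedge[OF \<G>]) (simp add: verts_kneser)
  then obtain \<M> i where \<M>: "\<M> \<in> hyperedges (kneser p \<G>)" "\<forall>S\<in>\<M>. c' S = i"
    by blast
  then have "\<M> \<subseteq> \<G>" by (simp add: in_hyperedges_kneser_iff)
  then have "(\<Union>S\<in>\<M>. E S) \<in> hyperedges (kneser (p * d) \<F>)"
    using E assms(3-5) by (intro UN_in_hyperedges_kneser[OF \<M>(1)]) blast+
  moreover have "c T = i" if "S \<in> \<M>" "T \<in> E S" for S T
  proof -
    have "c T = c' S" using E that \<open>\<M> \<subseteq> \<G>\<close> by blast
    then show ?thesis using \<M>(2) that(1) by simp
  qed
  then have "monochromatic c (\<Union>S\<in>\<M>. E S)"
    by (auto simp: monochromatic_def)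
  ultimately show False using c by (simp add: is_coloring_def)
qed

section \<open>Thin sets\<close>

definition thin_sets :: "'a set \<Rightarrow> 'a set \<Rightarrow> nat \<Rightarrow> nat \<Rightarrow> 'a set set" where
  "thin_sets V A a N = {S. S \<subseteq> V \<and> card S = N \<and> card (S \<inter> A) \<le> a}"

definition capped_card :: "'a set \<Rightarrow> nat \<Rightarrow> 'a set \<Rightarrow> nat" where
  "capped_card A a B = min (card (B \<inter> A)) a + card (B - A)"

lemma thin_sets_below:
  assumes "S \<subseteq> V"
  shows "{T \<in> thin_sets V A a N. T \<subseteq> S} = thin_sets S (S \<inter> A) a N"
proof -
  have "T \<inter> (S \<inter> A) = T \<inter> A" if "T \<subseteq> S" for T using that by blast
  then show ?thesis using assms by (auto simp: thin_sets_def)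
qed

lemma empty_notin_thin_sets: "N > 0 \<Longrightarrow> {} \<notin> thin_sets V A a N"
  by (simp add: thin_sets_def)

lemma thin_sets_nonempty:
  assumes "finite B" "N \<le> capped_card A a B"
  shows "thin_sets B A a N \<noteq> {}"
proof -
  obtain C where C: "C \<subseteq> B \<inter> A" "card C = min (card (B \<inter> A)) a"
    by (rule obtain_subset_with_card_n[OF min.cobounded1])
  have "finite C" using C(1) by (rule finite_subset) (simp add: assms(1))
  have "card (C \<union> (B - A)) = card C + card (B - A)"
    using C(1) \<open>finite C\<close> assms(1) by (intro card_Un_disjoint) auto
  then have "N \<le> card (C \<union> (B - A))" using C(2) assms(2) by (simp add: capped_card_def)
  then obtain S where S: "S \<subseteq> C \<union> (B - A)" "card S = N"
    by (rule obtain_subset_with_card_n)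
  have "card (S \<inter> A) \<le> card C" using S(1) \<open>finite C\<close> by (intro card_mono) auto
  then have "S \<in> thin_sets B A a N" using C S by (auto simp: thin_sets_def)
  then show ?thesis by blast
qed

lemma capped_card_eq_card:
  assumes "finite B" "card (B \<inter> A) \<le> a"
  shows "capped_card A a B = card B"
  using assms card_Int_Diff[of B A] by (simp add: capped_card_def)

lemma min_card_Int_mono:
  "B \<subseteq> C \<Longrightarrow> finite C \<Longrightarrow> min (card (B \<inter> A)) a \<le> min (card (C \<inter> A)) a"
  by (intro min.mono card_mono) auto

lemma capped_card_mono:
  "B \<subseteq> C \<Longrightarrow> finite C \<Longrightarrow> capped_card A a B \<le> capped_card A a C"
  unfolding capped_card_def by (intro add_mono min_card_Int_mono card_mono) auto

lemma capped_card_eqD: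
  assumes "B \<subseteq> C" "finite C" "capped_card A a B = capped_card A a C"
  shows "min (card (B \<inter> A)) a = min (card (C \<inter> A)) a" and "B - A = C - A"
proof -
  have "card (B - A) \<le> card (C - A)" using assms(1,2) by (intro card_mono) auto
  with min_card_Int_mono[OF assms(1,2), of A a] assms(3)
  have eq: "min (card (B \<inter> A)) a = min (card (C \<inter> A)) a" "card (B - A) = card (C - A)"
    unfolding capped_card_def by linarith+
  then show "min (card (B \<inter> A)) a = min (card (C \<inter> A)) a" by simp
  show "B - A = C - A" using eq(2) assms(1,2) by (intro card_subset_eq) auto
qed

lemma capped_card_pos:
  assumes "finite B" "B \<noteq> {}" "A = {} \<or> a > 0"
  shows "capped_card A a B > 0"
proof (cases "B \<subseteq> A")
  case True
  then show ?thesis using assms by (auto simp: capped_card_def Int_absorb2 card_gt_0_iff)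
next
  case False
  then have "card (B - A) > 0" using assms(1) by (auto simp: card_gt_0_iff)
  then show ?thesis by (simp add: capped_card_def)
qed

lemma subset_UN_if_card_Int_ge:
  assumes "finite I" "disjoint_family_on F I" "finite A" "card A \<le> card I * a"
    and "\<And>i. i \<in> I \<Longrightarrow> a \<le> card (F i \<inter> A)"
  shows "A \<subseteq> (\<Union>i\<in>I. F i)"
proof -
  have "card I * a \<le> (\<Sum>i\<in>I. card (F i \<inter> A))"
    using sum_bounded_below[of I a "\<lambda>i. card (F i \<inter> A)"] assms(5) by simp
  also have "\<dots> = card (\<Union>i\<in>I. F i \<inter> A)"
    using assms(1-3) by (intro card_UN_disjoint'[symmetric]) (auto simp: disjoint_family_on_def)
  finally have "(\<Union>i\<in>I. F i \<inter> A) = A"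
    using assms(3,4) by (intro card_seteq) auto
  then show ?thesis by blast
qed

lemma disjoint_family_eq_if_capped_card_eq:
  assumes "finite I" "disjoint_family_on G I" "finite A" "card A \<le> card I * a"
    and sub: "\<And>i. i \<in> I \<Longrightarrow> F i \<subseteq> G i" and fin: "\<And>i. i \<in> I \<Longrightarrow> finite (G i)"
    and eq: "\<And>i. i \<in> I \<Longrightarrow> capped_card A a (F i) = capped_card A a (G i)"
    and const: "\<And>i j. i \<in> I \<Longrightarrow> j \<in> I \<Longrightarrow> min (card (F i \<inter> A)) a = min (card (F j \<inter> A)) a"
    and "i \<in> I"
  shows "F i = G i"
proof -
  note eqD = capped_card_eqD[OF sub fin eq, OF \<open>i \<in> I\<close> \<open>i \<in> I\<close> \<open>i \<in> I\<close>]
  have "F i \<inter> A = G i \<inter> A"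
  proof (cases "card (F i \<inter> A) < a")
    case True
    then have "card (F i \<inter> A) = card (G i \<inter> A)" using eqD(1) by linarith
    then show ?thesis using sub[OF \<open>i \<in> I\<close>] \<open>finite A\<close> by (intro card_subset_eq) auto
  next
    case False
    have "a \<le> card (F j \<inter> A)" if "j \<in> I" for j
      using const[OF \<open>i \<in> I\<close> that] False by linarith
    moreover have "disjoint_family_on F I"
      using assms(2) sub unfolding disjoint_family_on_def by blast
    ultimately have "A \<subseteq> (\<Union>j\<in>I. F j)"
      using assms(1,3,4) by (intro subset_UN_if_card_Int_ge)
    then have "x \<in> F i" if "x \<in> G i \<inter> A" for x
      using that sub disjoint_family_onD[OF assms(2) \<open>i \<in> I\<close>] by blast
    then show ?thesis using sub[OF \<open>i \<in> I\<close>] by blast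
  qed
  with eqD(2) show ?thesis by blast
qed

locale thin_coloring =
  fixes p a N m :: nat and V A :: "'a set" and c :: "'a set \<Rightarrow> nat"
  assumes prime: "prime p" and finite_V: "finite V" and A_subset: "A \<subseteq> V"
    and card_A: "card A \<le> p * a" and N_pos: "N > 0"
    and coloring: "is_coloring (kneser p (thin_sets V A a N)) m c"
begin

definition has_color :: "nat \<Rightarrow> 'a set \<Rightarrow> bool" where
  "has_color v B \<longleftrightarrow> (\<exists>S\<in>thin_sets V A a N. S \<subseteq> B \<and> c S = v)"

definition large :: "('a \<Rightarrow> nat option) \<Rightarrow> bool" where
  "large X \<longleftrightarrow> decisive p has_color X"

definition overlap_ge :: "nat \<Rightarrow> 'a set \<Rightarrow> bool" where
  "overlap_ge l B \<longleftrightarrow> l \<le> min (card (B \<inter> A)) a"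

definition rank :: "('a \<Rightarrow> nat option) \<Rightarrow> nat" where
  "rank X = (if large X then p * (N - 1) + (\<Sum>v=1..m. card (selected p has_color X v))
     else \<Sum>i<p. capped_card A a (fibre X i))"

definition rank_sign :: "('a \<Rightarrow> nat option) \<Rightarrow> nat" where
  "rank_sign X = (if large X then family_sign p has_color X
     else if decisive p overlap_ge X then family_sign p overlap_ge X
     else family_sign p (\<in>) X)"

lemma p_ge_2: "p \<ge> 2"
  using prime by (rule prime_ge_2_nat)

lemma finite_A: "finite A"
  using A_subset finite_V by (rule finite_subset)

lemma finite_fibre: "X \<in> pmaps p V \<Longrightarrow> finite (fibre X i)"
  using fibre_subset finite_V by (rule finite_subset)

lemma capped_card_fibre_mono:
  assumes "X \<subseteq>\<^sub>m Y" "Y \<in> pmaps p V"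
  shows "capped_card A a (fibre X i) \<le> capped_card A a (fibre Y i)"
  using assms by (intro capped_card_mono fibre_mono finite_fibre)

lemma selected_has_color_mono:
  "X \<subseteq>\<^sub>m Y \<Longrightarrow> selected p has_color X v \<subseteq> selected p has_color Y v"
  by (rule selected_mono) (auto simp: has_color_def)

lemma selected_has_color_neq: "selected p has_color X v \<noteq> {..<p}"
proof
  assume "selected p has_color X v = {..<p}"
  then have "\<forall>i\<in>{..<p}. i \<in> selected p has_color X v" by simp
  then have "\<forall>i\<in>{..<p}. \<exists>S. S \<in> thin_sets V A a N \<and> S \<subseteq> fibre X i \<and> c S = v"
    by (simp add: selected_def has_color_def Bex_def)
  then obtain S where S: "\<forall>i\<in>{..<p}. S i \<in> thin_sets V A a N \<and> S i \<subseteq> fibre X i \<and> c (S i) = v"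
    unfolding bchoice_iff by (elim exE)
  have "disjoint_family_on S {..<p}"
  proof (rule disjoint_family_on_bisimulation[OF disjoint_family_on_fibre])
    fix i j assume "i \<in> {..<p}" "j \<in> {..<p}" "fibre X i \<inter> fibre X j = {}"
    then show "S i \<inter> S j = {}" using S by blast
  qed
  then have "S ` {..<p} \<in> hyperedges (kneser (card {..<p}) (thin_sets V A a N))"
    using S empty_notin_thin_sets[OF N_pos, of V A a] by (intro image_in_hyperedges_kneser) auto
  moreover have "monochromatic c (S ` {..<p})"
    using S by (auto simp: monochromatic_def)
  ultimately show False using coloring by (auto simp: is_coloring_def)
qed

lemma proper_selected_has_color_iff:
  "proper p (selected p has_color X v) \<longleftrightarrow> selected p has_color X v \<noteq> {}"
  using selected_has_color_neq[of X v] selected_subset[of p has_color X v]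
  by (auto simp: proper_def)

lemma selected_has_color_outside:
  assumes "v \<notin> {1..m}"
  shows "selected p has_color X v = {}"
proof -
  have "c S \<in> {1..m}" if "S \<in> thin_sets V A a N" for S
    using that coloring by (simp add: is_coloring_def verts_kneser)
  then have "\<not> has_color v B" for B using assms by (auto simp: has_color_def)
  then show ?thesis by (simp add: selected_def)
qed

lemma large_iff: "large X \<longleftrightarrow> (\<exists>v. selected p has_color X v \<noteq> {})"
  by (simp add: large_def decisive_def proper_selected_has_color_iff)

lemma large_mono: "X \<subseteq>\<^sub>m Y \<Longrightarrow> large X \<Longrightarrow> large Y"
  using selected_has_color_mono unfolding large_iff by blast

lemma sum_selected_pos:
  assumes "large X"
  shows "0 < (\<Sum>v=1..m. card (selected p has_color X v))"
proof -
  obtain v where v: "selected p has_color X v \<noteq> {}" using assms by (auto simp: large_iff)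
  then have "v \<in> {1..m}" using selected_has_color_outside by blast
  then show ?thesis
    using v by (intro sum_pos2[of _ v]) (auto simp: card_gt_0_iff finite_selected)
qed

lemma sum_selected_le: "(\<Sum>v=1..m. card (selected p has_color X v)) \<le> (p - 1) * m"
proof -
  have "card (selected p has_color X v) \<le> p - 1" for v
  proof -
    have "selected p has_color X v \<subset> {..<p}"
      using selected_subset selected_has_color_neq by (rule psubsetI)
    from psubset_card_mono[OF _ this] show ?thesis by simp
  qed
  then show ?thesis
    using sum_bounded_above[of "{1..m}" "\<lambda>v. card (selected p has_color X v)" "p - 1"]
    by (simp add: mult.commute)
qed

lemma capped_card_fibre_le:
  assumes "X \<in> pmaps p V" "\<not> large X" "i < p"
  shows "capped_card A a (fibre X i) \<le> N - 1"
proof (rule ccontr)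
  assume "\<not> capped_card A a (fibre X i) \<le> N - 1"
  then have "thin_sets (fibre X i) A a N \<noteq> {}"
    by (intro thin_sets_nonempty finite_fibre[OF assms(1)]) simp
  then obtain S where "S \<in> thin_sets V A a N" "S \<subseteq> fibre X i"
    using fibre_subset[OF assms(1)] by (auto simp: thin_sets_def)
  then have "i \<in> selected p has_color X (c S)"
    using assms(3) by (auto simp: selected_def has_color_def)
  then show False using assms(2) large_iff by blast
qed

lemma sum_capped_card_le:
  assumes "X \<in> pmaps p V" "\<not> large X"
  shows "(\<Sum>i<p. capped_card A a (fibre X i)) \<le> p * (N - 1)"
  using sum_bounded_above[of "{..<p}" "\<lambda>i. capped_card A a (fibre X i)" "N - 1"]
    capped_card_fibre_le[OF assms] by simp

lemma sum_capped_card_pos: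
  assumes "X \<in> pmaps p V"
  shows "0 < (\<Sum>i<p. capped_card A a (fibre X i))"
proof -
  obtain x i where "X x = Some i" "i < p" using assms by (rule pmapsE)
  moreover have "A = {} \<or> a > 0"
    using card_A finite_A by (cases a) auto
  ultimately show ?thesis
    using finite_fibre[OF assms]
    by (intro sum_pos2[of _ i] capped_card_pos) (auto simp: fibre_def)
qed

lemma rank_bounds:
  assumes "X \<in> pmaps p V"
  shows "rank X \<in> {1..(p - 1) * m + p * (N - 1)}"
  using sum_capped_card_le[OF assms] sum_capped_card_pos[OF assms]
    sum_selected_pos[of X] sum_selected_le[of X]
  by (cases "large X") (auto simp: rank_def)

lemma card_selected_has_color_mono:
  "X \<subseteq>\<^sub>m Y \<Longrightarrow> card (selected p has_color X v) \<le> card (selected p has_color Y v)"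
  by (intro card_mono selected_has_color_mono finite_selected)

lemma rank_less_if_large:
  assumes "X \<in> pmaps p V" "\<not> large X" "large Y"
  shows "rank X < rank Y"
  using assms sum_capped_card_le[of X] sum_selected_pos[of Y] by (simp add: rank_def)

lemma rank_mono:
  assumes "X \<in> pmaps p V" "Y \<in> pmaps p V" "X \<subseteq>\<^sub>m Y"
  shows "rank X \<le> rank Y"
proof -
  consider "large X" "large Y" | "\<not> large X" "large Y" | "\<not> large X" "\<not> large Y"
    using large_mono[OF assms(3)] by blast
  then show ?thesis
  proof cases
    case 1
    then show ?thesis
      using card_selected_has_color_mono[OF assms(3)] by (simp add: rank_def sum_mono)
  next
    case 2
    then show ?thesis using rank_less_if_large[OF assms(1)] by (simp add: less_imp_le)
  next
    case 3
    then show ?thesis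
      using capped_card_fibre_mono[OF assms(3,2)] by (simp add: rank_def sum_mono)
  qed
qed

lemma selected_has_color_eq_if_rank_eq:
  assumes "X \<subseteq>\<^sub>m Y" "large X" "rank X = rank Y"
  shows "selected p has_color X = selected p has_color Y"
proof
  fix v
  show "selected p has_color X v = selected p has_color Y v"
  proof (cases "v \<in> {1..m}")
    case True
    have "(\<Sum>v=1..m. card (selected p has_color X v)) = (\<Sum>v=1..m. card (selected p has_color Y v))"
      using assms(2,3) large_mono[OF assms(1,2)] by (simp add: rank_def)
    from sum_mono_inv[OF this card_selected_has_color_mono[OF assms(1)] True]
    have "card (selected p has_color X v) = card (selected p has_color Y v)" by simp
    then show ?thesis
      using selected_has_color_mono[OF assms(1)] by (intro card_subset_eq finite_selected)
  next
    case False
    show ?thesis unfolding selected_has_color_outside[OF False] ..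
  qed
qed

lemma capped_card_fibre_eq_if_rank_eq:
  assumes "Y \<in> pmaps p V" "X \<subseteq>\<^sub>m Y" "\<not> large X" "\<not> large Y" "rank X = rank Y" "i < p"
  shows "capped_card A a (fibre X i) = capped_card A a (fibre Y i)"
proof -
  have "(\<Sum>i<p. capped_card A a (fibre X i)) = (\<Sum>i<p. capped_card A a (fibre Y i))"
    using assms(3-5) by (simp add: rank_def)
  from sum_mono_inv[OF this capped_card_fibre_mono[OF assms(2,1)]] show ?thesis
    using assms(6) by simp
qed

lemma selected_overlap_ge_eq:
  assumes "\<And>i. i < p \<Longrightarrow> min (card (fibre X i \<inter> A)) a = min (card (fibre Y i \<inter> A)) a"
  shows "selected p overlap_ge X = selected p overlap_ge Y"
  by (simp add: fun_eq_iff selected_def overlap_ge_def assms cong: conj_cong del: min.bounded_iff)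

lemma eq_if_rank_eq:
  assumes "X \<in> pmaps p V" "Y \<in> pmaps p V" "X \<subseteq>\<^sub>m Y" "\<not> large X" "\<not> large Y" "rank X = rank Y"
    and "\<not> decisive p overlap_ge X"
  shows "X = Y"
proof (rule map_eq_if_fibre_eq)
  show "ran X \<subseteq> {..<p}" "ran Y \<subseteq> {..<p}" using assms(1,2) by (auto simp: pmaps_def)
next
  fix i assume "i < p"
  then show "fibre X i = fibre Y i"
  proof (intro disjoint_family_eq_if_capped_card_eq[of "{..<p}"])
    show "capped_card A a (fibre X j) = capped_card A a (fibre Y j)" if "j \<in> {..<p}" for j
      using that assms(2-6) by (intro capped_card_fibre_eq_if_rank_eq) auto
    show "min (card (fibre X j \<inter> A)) a = min (card (fibre X l \<inter> A)) a"
      if "j \<in> {..<p}" "l \<in> {..<p}" for j l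
      using that assms(7) const_on_fibres_if_not_decisive[of p "\<lambda>B. min (card (B \<inter> A)) a" X j l]
      by (simp add: overlap_ge_def[abs_def])
  qed (use finite_A card_A disjoint_family_on_fibre fibre_mono[OF assms(3)]
      finite_fibre[OF assms(2)] in auto)
qed

lemma rank_sign_eq_if_rank_eq:
  assumes "X \<in> pmaps p V" "Y \<in> pmaps p V" "X \<subseteq>\<^sub>m Y" "rank X = rank Y"
  shows "rank_sign X = rank_sign Y"
proof -
  have "large X \<longleftrightarrow> large Y"
    using rank_less_if_large[OF assms(1)] large_mono[OF assms(3)] assms(4) by fastforce
  then consider "large X" "large Y" | "\<not> large X" "\<not> large Y" by blast
  then show ?thesis
  proof cases
    case 1
    then show ?thesis
      using selected_has_color_eq_if_rank_eq[OF assms(3) _ assms(4)]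
      by (simp add: rank_sign_def family_sign_def)
  next
    case 2
    show ?thesis
    proof (cases "decisive p overlap_ge X")
      case True
      have "selected p overlap_ge X = selected p overlap_ge Y"
        using assms 2
        by (intro selected_overlap_ge_eq capped_card_eqD(1) fibre_mono finite_fibre
            capped_card_fibre_eq_if_rank_eq)
      then show ?thesis using True 2 by (simp add: rank_sign_def family_sign_def decisive_def)
    next
      case False
      then show ?thesis using eq_if_rank_eq[OF assms(1-3) 2 assms(4)] by simp
    qed
  qed
qed

lemma equivariant_rank_sign: "equivariant p V rank_sign"
  unfolding equivariant_def
proof (intro ballI conjI)
  fix X assume X: "X \<in> pmaps p V"
  show "rank_sign X < p"
    using p_ge_2 by (simp add: rank_sign_def family_sign_less)
  have ran: "ran X \<subseteq> {..<p}" using X by (simp add: pmaps_def)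
  show "rank_sign (act p X) = shift p (rank_sign X)"
    using decisive_member[OF X p_ge_2]
    by (simp add: rank_sign_def large_def decisive_act[OF ran] family_sign_act[OF prime ran])
qed

lemma card_V_le: "card V \<le> (p - 1) * m + p * (N - 1)"
proof -
  have "card V \<le> card {1..(p - 1) * m + p * (N - 1)}"
    using finite_V p_ge_2 equivariant_rank_sign
  proof (rule cyclic_Tucker)
    show "rank ` pmaps p V \<subseteq> {1..(p - 1) * m + p * (N - 1)}"
      using rank_bounds by (rule image_subsetI)
  qed (fact finite_atLeastAtMost rank_mono rank_sign_eq_if_rank_eq)+
  then show ?thesis by simp
qed

end

lemma not_colorable_kneser_thin_sets_prime:
  assumes "prime p" "finite V" "A \<subseteq> V" "card A \<le> p * a" "N > 0"
    and "(p - 1) * m + p * (N - 1) < card V"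
  shows "\<not> colorable (kneser p (thin_sets V A a N)) m"
proof
  assume "colorable (kneser p (thin_sets V A a N)) m"
  then obtain c where "is_coloring (kneser p (thin_sets V A a N)) m c"
    by (auto simp: colorable_def)
  then interpret thin_coloring p a N m V A c
    using assms by unfold_locales
  show False using card_V_le assms(6) by simp
qed

lemma not_colorable_kneser_1:
  assumes "\<F> \<noteq> {}"
  shows "\<not> colorable (kneser 1 \<F>) m"
proof -
  obtain S where "S \<in> \<F>" using assms by blast
  then have "{S} \<in> hyperedges (kneser 1 \<F>)" by (simp add: in_hyperedges_kneser_iff)
  moreover have "monochromatic c {S}" for c by (simp add: monochromatic_def)
  ultimately show ?thesis unfolding colorable_def is_coloring_def by blast
qed

theorem not_colorable_kneser_thin_sets:
  assumes "r > 0" "finite V" "A \<subseteq> V" "card A \<le> r * a" "N > 0"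
    and "(r - 1) * m + r * (N - 1) < card V"
  shows "\<not> colorable (kneser r (thin_sets V A a N)) m"
  using assms
proof (induction r arbitrary: V A rule: prime_divisors_induct)
  case (unit r)
  then have "card (V \<inter> A) \<le> a" "N \<le> card V" by (simp_all add: Int_absorb1)
  with \<open>finite V\<close> have "N \<le> capped_card A a V" by (simp add: capped_card_eq_card)
  with \<open>finite V\<close> have "thin_sets V A a N \<noteq> {}" by (rule thin_sets_nonempty)
  then show ?case using unit.hyps not_colorable_kneser_1 by simp
next
  case (factor p d)
  define M where "M = (d - 1) * m + d * (N - 1) + 1"
  have "p > 0" "d > 0" using factor.prems(1) by simp_all
  have "\<not> colorable (kneser p (thin_sets V A (d * a) M)) m"
  proof (rule not_colorable_kneser_thin_sets_prime[OF factor.hyps(1) factor.prems(2,3)])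
    show "card A \<le> p * (d * a)" using factor.prems(4) by (simp add: mult.assoc)
    obtain p' d' l where "p = Suc p'" "d = Suc d'" "N = Suc l"
      using \<open>p > 0\<close> \<open>d > 0\<close> \<open>N > 0\<close> by (auto simp: gr0_conv_Suc)
    then have "(p - 1) * m + p * (M - 1) = (p * d - 1) * m + p * d * (N - 1)"
      by (simp add: M_def algebra_simps)
    then show "(p - 1) * m + p * (M - 1) < card V" using factor.prems(6) by simp
  qed (simp add: M_def)
  moreover have "\<not> colorable (kneser d {T \<in> thin_sets V A a N. T \<subseteq> S}) m"
    if "S \<in> thin_sets V A (d * a) M" for S
  proof -
    have S: "S \<subseteq> V" "card S = M" "card (S \<inter> A) \<le> d * a"
      using that by (simp_all add: thin_sets_def)
    have "\<not> colorable (kneser d (thin_sets S (S \<inter> A) a N)) m"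
      using S \<open>d > 0\<close> factor.prems(2,5)
      by (intro factor.IH) (auto simp: M_def intro: finite_subset)
    then show ?thesis by (simp add: thin_sets_below[OF S(1)])
  qed
  ultimately show ?case
    using \<open>p > 0\<close> \<open>d > 0\<close> empty_notin_thin_sets[OF factor.prems(5)]
    by (intro not_colorable_kneser_mult)
qed simp

section \<open>Colorings by blocks of minima\<close>

definition block :: "nat \<Rightarrow> nat \<Rightarrow> nat" where
  "block q x = (x - 1) div q + 1"

lemma block_bounds:
  assumes "q > 0" "x > 0"
  shows "(block q x - 1) * q < x" and "x \<le> block q x * q"
proof -
  show "(block q x - 1) * q < x"
    using assms(2) le_less_trans[OF div_times_less_eq_dividend, of "x - 1" x q]
    by (simp add: block_def)
  show "x \<le> block q x * q"
    using assms dividend_less_times_div[of q "x - 1"] by (simp add: block_def algebra_simps)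
qed

lemma card_le_if_Min_mem:
  fixes e :: "'a::linorder set set"
  assumes "pairwise disjnt e" "finite B"
    and "\<And>\<sigma>. \<sigma> \<in> e \<Longrightarrow> finite \<sigma> \<and> \<sigma> \<noteq> {} \<and> Min \<sigma> \<in> B"
  shows "card e \<le> card B"
proof (rule card_inj_on_le[where f = Min])
  show "inj_on Min e"
  proof (rule inj_onI, rule ccontr)
    fix \<sigma> \<tau> assume \<sigma>\<tau>: "\<sigma> \<in> e" "\<tau> \<in> e" "Min \<sigma> = Min \<tau>" "\<sigma> \<noteq> \<tau>"
    then have "Min \<sigma> \<in> \<sigma>" "Min \<sigma> \<in> \<tau>"
      using assms(3)[OF \<sigma>\<tau>(1)] assms(3)[OF \<sigma>\<tau>(2)] Min_in[of \<sigma>] Min_in[of \<tau>] by simp_all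
    moreover have "disjnt \<sigma> \<tau>" using assms(1) \<sigma>\<tau> by (simp add: pairwise_def)
    ultimately show False by (auto simp: disjnt_def)
  qed
qed (use assms in auto)

lemma card_mult_le_card_Union:
  assumes "pairwise disjnt e" "\<And>\<sigma>. \<sigma> \<in> e \<Longrightarrow> finite \<sigma> \<and> k \<le> card \<sigma>"
  shows "card e * k \<le> card (\<Union>e)"
proof -
  have "card e * k \<le> (\<Sum>\<sigma>\<in>e. card \<sigma>)"
    using sum_bounded_below[of e k card] assms(2) by simp
  also have "\<dots> = card (\<Union>e)"
    using assms by (intro card_Union_disjoint[symmetric]) auto
  finally show ?thesis .
qed

lemma card_le_if_block_Min_eq:
  assumes "q > 0" "pairwise disjnt e"
    and e: "\<And>\<sigma>. \<sigma> \<in> e \<Longrightarrow> \<sigma> \<subseteq> {1..n} \<and> \<sigma> \<noteq> {} \<and> block q (Min \<sigma>) = i"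
  shows "card e \<le> q"
proof -
  have "card e \<le> card {(i - 1) * q<..i * q}"
    using assms(2)
  proof (rule card_le_if_Min_mem)
    fix \<sigma> assume \<sigma>: "\<sigma> \<in> e"
    then have "finite \<sigma>" using e finite_subset by blast
    then have "Min \<sigma> > 0" using Min_in[of \<sigma>] e[OF \<sigma>] by auto
    from block_bounds[OF \<open>q > 0\<close> this] \<open>finite \<sigma>\<close> e[OF \<sigma>]
    show "finite \<sigma> \<and> \<sigma> \<noteq> {} \<and> Min \<sigma> \<in> {(i - 1) * q<..i * q}" by simp
  qed simp
  also have "\<dots> \<le> q" by (cases i) simp_all
  finally show ?thesis .
qed

lemma card_mult_le_if_block_Min_ge:
  assumes "q > 0" "pairwise disjnt e"
    and e: "\<And>\<sigma>. \<sigma> \<in> e \<Longrightarrow> \<sigma> \<subseteq> {1..n} \<and> k \<le> card \<sigma> \<and> m \<le> block q (Min \<sigma>)"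
  shows "card e * k \<le> n - (m - 1) * q"
proof -
  have "x \<in> {(m - 1) * q<..n}" if "\<sigma> \<in> e" "x \<in> \<sigma>" for \<sigma> x
  proof -
    have \<sigma>: "finite \<sigma>" "\<sigma> \<subseteq> {1..n}" using e[OF that(1)] finite_subset by blast+
    then have "Min \<sigma> \<in> \<sigma>" using that(2) by (intro Min_in) auto
    then have "Min \<sigma> > 0" using \<sigma>(2) by auto
    have "(m - 1) * q \<le> (block q (Min \<sigma>) - 1) * q"
      using e[OF that(1)] by (intro mult_le_mono1 diff_le_mono) simp
    also have "\<dots> < Min \<sigma>" using \<open>q > 0\<close> \<open>Min \<sigma> > 0\<close> by (rule block_bounds)
    also have "\<dots> \<le> x" using \<sigma>(1) that(2) by (rule Min_le)
    finally show ?thesis using \<sigma>(2) that(2) by auto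
  qed
  then have "card (\<Union>e) \<le> card {(m - 1) * q<..n}" by (intro card_mono) auto
  moreover have "card e * k \<le> card (\<Union>e)"
    using assms(2) by (rule card_mult_le_card_Union) (use e finite_subset in blast)
  ultimately show ?thesis by simp
qed

theorem colorable_kneser_if_le:
  assumes "r \<ge> 2" "k > 0" "m > 0" "n \<le> r * (k - 1) + m * (r - 1)"
    and \<F>: "\<And>\<sigma>. \<sigma> \<in> \<F> \<Longrightarrow> \<sigma> \<subseteq> {1..n} \<and> k \<le> card \<sigma>"
  shows "colorable (kneser r \<F>) m"
proof -
  define c where "c \<sigma> = min m (block (r - 1) (Min \<sigma>))" for \<sigma>
  have r: "r - 1 > 0" using \<open>r \<ge> 2\<close> by simp
  have "\<not> monochromatic c e" if "e \<in> hyperedges (kneser r \<F>)" for e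
  proof
    have e: "e \<subseteq> \<F>" "card e = r" "pairwise disjnt e"
      using that by (simp_all add: in_hyperedges_kneser_iff)
    assume "monochromatic c e"
    then obtain i where i: "\<And>\<sigma>. \<sigma> \<in> e \<Longrightarrow> c \<sigma> = i" by (auto simp: monochromatic_def)
    show False
    proof (cases "i < m")
      case True
      have "card e \<le> r - 1"
      proof (rule card_le_if_block_Min_eq[OF r e(3)])
        fix \<sigma> assume "\<sigma> \<in> e"
        then show "\<sigma> \<subseteq> {1..n} \<and> \<sigma> \<noteq> {} \<and> block (r - 1) (Min \<sigma>) = i"
          using i[of \<sigma>] True \<F>[of \<sigma>] e(1) \<open>k > 0\<close> by (auto simp: c_def)
      qed
      then show False using e(2) r by simp
    next
      case False
      have "card e * k \<le> n - (m - 1) * (r - 1)"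
      proof (rule card_mult_le_if_block_Min_ge[OF r e(3)])
        fix \<sigma> assume "\<sigma> \<in> e"
        then show "\<sigma> \<subseteq> {1..n} \<and> k \<le> card \<sigma> \<and> m \<le> block (r - 1) (Min \<sigma>)"
          using i[of \<sigma>] False \<F>[of \<sigma>] e(1) by (auto simp: c_def)
      qed
      moreover obtain m' k' r' where "m = Suc m'" "k = Suc k'" "r = Suc r'"
        using assms(1-3) by (cases m; cases k; cases r) auto
      ultimately show False using assms(4) e(2) by (simp add: algebra_simps)
    qed
  qed
  moreover have "c \<sigma> \<in> {1..m}" for \<sigma> using \<open>m > 0\<close> by (simp add: c_def block_def)
  ultimately show ?thesis by (auto simp: colorable_def is_coloring_def)
qed

section \<open>The chromatic number\<close>

lemma b_num_le:
  assumes "r > 0"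
  shows "b_num r \<le> r"
proof -
  let ?P = "prime_factors r"
  have "(\<Prod>p\<in>?P - {2}. (p - 1) ^ multiplicity p r) \<le> (\<Prod>p\<in>?P - {2}. p ^ multiplicity p r)"
    by (intro prod_mono) (simp add: power_mono)
  then have "b_num r \<le> 2 ^ multiplicity 2 r * (\<Prod>p\<in>?P - {2}. p ^ multiplicity p r)"
    by (simp add: b_num_def)
  also have "\<dots> = (\<Prod>p\<in>?P. p ^ multiplicity p r)"
  proof (cases "2 \<in> ?P")
    case True
    then show ?thesis using prod.remove[of ?P 2 "\<lambda>p. p ^ multiplicity p r"] by simp
  next
    case False
    then have "multiplicity 2 r = 0"
      using assms by (auto simp: prime_factors_multiplicity)
    then show ?thesis using False by simp
  qed
  also have "\<dots> = r" using assms by (simp add: prod_prime_factors)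
  finally show ?thesis .
qed

lemma KG_avoid_eq_kneser:
  assumes "k > 0"
  shows "KG_avoid r A n k = kneser r (thin_sets {1..n} A (k - 1) k)"
proof -
  have "\<not> \<sigma> \<subseteq> A \<longleftrightarrow> card (\<sigma> \<inter> A) \<le> k - 1" if "\<sigma> \<subseteq> {1..n}" "card \<sigma> = k" for \<sigma>
  proof
    have "finite \<sigma>" using that(1) finite_subset by blast
    assume "\<not> \<sigma> \<subseteq> A"
    then have "card (\<sigma> \<inter> A) < card \<sigma>"
      using \<open>finite \<sigma>\<close> by (intro psubset_card_mono) auto
    then show "card (\<sigma> \<inter> A) \<le> k - 1" using that(2) by simp
  next
    assume "card (\<sigma> \<inter> A) \<le> k - 1"
    then show "\<not> \<sigma> \<subseteq> A" using that(2) assms by (auto simp: Int_absorb2)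
  qed
  then have "{\<sigma>. \<sigma> \<subseteq> {1..n} \<and> card \<sigma> = k} \<inter> {\<sigma>. \<not> \<sigma> \<subseteq> A} = thin_sets {1..n} A (k - 1) k"
    by (auto simp: thin_sets_def)
  moreover have "KG_avoid r A n k = kneser r ({\<sigma>. \<sigma> \<subseteq> {1..n} \<and> card \<sigma> = k} \<inter> {\<sigma>. \<not> \<sigma> \<subseteq> A})"
    unfolding KG_avoid_def induced_subhypergraph_def KG_def kneser_def verts_def hyperedges_def
      Let_def by auto
  ultimately show ?thesis by simp
qed

lemma colorable_KG_avoid_iff:
  assumes "r \<ge> 2" "k > 0" "A \<subseteq> {1..n}" "card A \<le> r * (k - 1)" "r * (k - 1) < n"
  shows "colorable (KG_avoid r A n k) m \<longleftrightarrow> n \<le> r * (k - 1) + m * (r - 1)"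
proof
  assume "colorable (KG_avoid r A n k) m"
  then show "n \<le> r * (k - 1) + m * (r - 1)"
    using not_colorable_kneser_thin_sets[of r "{1..n}" A "k - 1" k m] assms
    by (force simp: KG_avoid_eq_kneser mult.commute)
next
  assume n: "n \<le> r * (k - 1) + m * (r - 1)"
  then have "m > 0" using assms(5) by (cases m) auto
  then show "colorable (KG_avoid r A n k) m"
    unfolding KG_avoid_eq_kneser[OF assms(2)] using assms(1,2) n
    by (intro colorable_kneser_if_le[of r k m n]) (auto simp: thin_sets_def)
qed

theorem chromatic_number_KG_avoid:
  assumes "r \<ge> 2" "k > 0" "A \<subseteq> {1..n}" "card A \<le> r * (k - 1)" "r * (k - 1) < n"
  shows "chromatic_number (KG_avoid r A n k)
    = nat \<lceil>(real n - real (r * (k - 1))) / (real r - 1)\<rceil>"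
proof (rule chromatic_number_eq_if_colorable_iff)
  fix m
  have "real r - 1 > 0" using assms(1) by simp
  then have "nat \<lceil>(real n - real (r * (k - 1))) / (real r - 1)\<rceil> \<le> m
      \<longleftrightarrow> real n - real (r * (k - 1)) \<le> real m * (real r - 1)"
    by (simp add: pos_divide_le_eq del: of_nat_mult)
  also have "\<dots> \<longleftrightarrow> real n \<le> real (r * (k - 1)) + real m * real (r - 1)"
    using assms(1) by (simp add: of_nat_diff algebra_simps del: of_nat_mult)
  finally show "colorable (KG_avoid r A n k) m
      \<longleftrightarrow> nat \<lceil>(real n - real (r * (k - 1))) / (real r - 1)\<rceil> \<le> m"
    by (simp only: colorable_KG_avoid_iff[OF assms] flip: of_nat_mult of_nat_add of_nat_le_iff)
qed

theorem theorem4p2: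
  fixes r k n :: nat and A :: "nat set"
  assumes "r \<ge> 2" and "k \<ge> 1" and "n \<ge> 2 * r * k"
    and "A \<subseteq> {1..n}" and "card A \<le> b_num r * (k - 1)"
  shows "int (chromatic_number (KG_avoid r A n k)) =
    \<lceil>(real n - real (max (r * (k - 1)) (card A))) / (real r - 1)\<rceil>"
proof -
  have "b_num r * (k - 1) \<le> r * (k - 1)"
    using \<open>r \<ge> 2\<close> b_num_le[of r] by (intro mult_right_mono) simp_all
  then have A: "card A \<le> r * (k - 1)" using assms(5) by (rule order_trans[rotated])
  have "r * (k - 1) < 2 * r * k"
    using assms(1,2) by (cases k) (auto simp: algebra_simps)
  then have n: "r * (k - 1) < n" using assms(3) by (rule less_le_trans)
  then have "(real n - real (r * (k - 1))) / (real r - 1) \<ge> 0"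
    using assms(1) by (intro divide_nonneg_nonneg) (simp_all del: of_nat_mult)
  then show ?thesis
    using chromatic_number_KG_avoid[OF assms(1) _ assms(4) A n] assms(2)
    unfolding max_absorb1[OF A] by simp
qed

end
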